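(* Consider the multi-output high-order system $\boldsymbol x_1^{(v)}=\boldsymbol p(\boldsymbol x)$, $\boldsymbol y=\boldsymbol x_1$, with $\omega$ outputs of equal observability index $v=n/\omega$, on the region $\Psi(\mathcal U)$. Let $\boldsymbol x_{1,j}$ denote the vector obtained from $\boldsymbol x_1\in\mathbb R^\omega$ by leaving its 1st through $j$-th components unchanged and replacing the other components by zeros. Then there exists a family of smooth vector-valued functions $\boldsymbol B_r(\boldsymbol x_1)=(B_{1,r}(\boldsymbol x_1),\ldots,B_{\omega,r}(\boldsymbol x_1))^\top$, $r=0,\ldots,v-1$, given by $$\boldsymbol B_0(\boldsymbol x_1)=\boldsymbol p(\boldsymbol x_1,0,\ldots,0),$$ $$B_{k,r}(\boldsymbol x_1)=\sum_{j=1}^{\omega}\int_0^{x_{s_j}}\frac{\partial p_k}{\partial x_{s_j+r}}\left(\boldsymbol x_{1,j},0,\ldots,0\right)\Big|_{x_{s_j}=s}\,\mathrm ds,\qquad k=1,\ldots,\omega,\ r=1,\ldots,v-1,$$ such that the system admits the multi-output high-order fully measured form $\boldsymbol p(\boldsymbol x)=\sum_{r=0}^{v-1}\boldsymbol D^r\boldsymbol B_r(\boldsymbol x_1)$ on $\Psi(\mathcal U)$, and can consequently be transformed into the multi-output observer canonical form, if and only if $\boldsymbol p$ satisfies the multi-output Pascal-Hessian condition on $\Psi(\mathcal U)$.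
   Context: Setting. A smooth system $\dot\chi=f(\chi)$, $\chi\in\mathbb R^n$, has outputs $\boldsymbol y=(h_1(\chi),\ldots,h_\omega(\chi))^\top\in\mathbb R^\omega$. All outputs have the same observability index $v=n/\omega$, i.e. the covector fields $\mathrm dL_f^{j}h_i(\chi)$, $i=1,\ldots,\omega$, $j=0,\ldots,v-1$, span a codistribution of dimension $n$ on a region $\mathcal U$. Here $L_fh=\frac{\partial h}{\partial\chi^\top}f$ and $L_f^kh=L_f(L_f^{k-1}h)$. Indices and coordinates: $s_i=(i-1)v+1$ for $i=1,\ldots,\omega$, and the diffeomorphism $x=\Psi(\chi)$ is given by $x_{s_i+j}=L_f^jh_i(\chi)$, $i=1,\ldots,\omega$, $j=0,\ldots,v-1$; in particular $y_i=x_{s_i}$. Put $\boldsymbol x_j=(x_{s_1+j-1},\ldots,x_{s_\omega+j-1})^\top$ for $j=1,\ldots,v$, and $\boldsymbol x=\operatorname{col}\{\boldsymbol x_1,\ldots,\boldsymbol x_v\}$ (stacked column vector). In these coordinates the system is $\dot{\boldsymbol x}_j=\boldsymbol x_{j+1}$ for $1\le j\le v-1$, $\dot{\boldsymbol x}_v=\boldsymbol p(\boldsymbol x)=(p_1(\boldsymbol x),\ldots,p_\omega(\boldsymbol x))^\top$, $\boldsymbol y=\boldsymbol x_1$, which is written $\boldsymbol x_1^{(v)}=\boldsymbol p(\boldsymbol x)$. The notation $(\boldsymbol x_1,0,\ldots,0)$ means $\boldsymbol x_2=\cdots=\boldsymbol x_v=0$, and similarly for $(\boldsymbol x_{1,j},0,\ldots,0)$.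 Total derivative operator: $\boldsymbol D=\sum_{k=1}^{\omega}\sum_{\ell=1}^{v-1}x_{s_k+\ell}\frac{\partial}{\partial x_{s_k+\ell-1}}$, applied componentwise to vector-valued functions; $\boldsymbol D^r$ is its $r$-fold iterate. The fully measured form is equivalently $\boldsymbol p(\boldsymbol x)=\sum_{r=0}^{v-1}\boldsymbol B_r^{(r)}(\boldsymbol x_1)$, with $(r)$ denoting the $r$-th time derivative along the system. Multi-output Pascal-Hessian condition: for $1\le i\le n$ let $a(i)=\lceil i/v\rceil$ and $\hat i=i-s_{a(i)}$. The condition on a region requires, on that region, for every $k=1,\ldots,\omega$ and all $1\le i,j\le n$, $$\frac{\partial^2p_k}{\partial x_i\partial x_j}=\begin{cases}\displaystyle\binom{\hat i+\hat j}{\hat i}\frac{\partial^2p_k}{\partial x_{s_{a(i)}}\partial x_{s_{a(j)}+\hat i+\hat j}},&\hat i+\hat j\le v-1,\\[1ex]0,&\hat i+\hat j>v-1.\end{cases}$$ Multi-output observer canonical form: $\dot z=Az+\alpha(\boldsymbol y)$, $\boldsymbol y=Cz$, with $z=\operatorname{col}\{z_1,\ldots,z_\omega\}\in\mathbb R^n$, $z_i\in\mathbb R^v$, $\alpha=\operatorname{col}\{\alpha_1,\ldots,\alpha_\omega\}$ a smooth function of $\boldsymbol y$ with blocks $\alpha_i(\boldsymbol y)\in\mathbb R^v$, $A=I_\omega\otimes A_0$, $C=I_\omega\otimes C_0$, where $A_0$ is the $v\times v$ matrix with ones on the first subdiagonal and zeros elsewhere and $C_0=[0\ \cdots\ 0\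 1]\in\mathbb R^{1\times v}$. Transformation into this form means by a diffeomorphic change of state coordinates.
   Formalization: The region Ψ(U) is additionally assumed to contain all points at which the formulas for B_0 and B_{k,r} evaluate p and its derivatives, and to have connected slices x_1 = const; without the latter the "if" direction fails. *)

theory Defs
  imports "HOL-Analysis.Analysis"
begin

text \<open>
  Finite linearly ordered index types stand for $\{1,\ldots,n\}$: \<open>idx i\<close> is the \<open>i\<close>-th smallest
  index, so \<open>x $$ i\<close> is the \<open>i\<close>-th component of \<open>x\<close> for \<open>1 \<le> i \<le> CARD('n)\<close>, and
  \<open>mkvec g\<close> is the column vector with components \<open>g 1, g 2, \<dots>\<close> (lemma \<open>coord_mkvec\<close>).
\<close>

type_synonym 'n rvec = "(real, 'n) vec"

definition pos :: "'n::{finite,linorder} \<Rightarrow> nat"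
  where "pos k = card {..k}"

definition idx :: "nat \<Rightarrow> 'n::{finite,linorder}"
  where "idx i = inv pos i"

definition coord :: "'a^'n::{finite,linorder} \<Rightarrow> nat \<Rightarrow> 'a"  (infixl "$$" 90)
  where "x $$ i = x $ idx i"

definition mkvec :: "(nat \<Rightarrow> 'a) \<Rightarrow> 'a^'n::{finite,linorder}"
  where "mkvec g = (\<chi> k. g (pos k))"

lemma strict_mono_pos: "strict_mono (pos :: 'n::{finite,linorder} \<Rightarrow> nat)"
  unfolding strict_mono_def pos_def by (auto intro!: psubset_card_mono)

lemma inj_pos: "inj (pos :: 'n::{finite,linorder} \<Rightarrow> nat)"
  using strict_mono_pos by (rule strict_mono_imp_inj_on)

lemma range_pos: "range (pos :: 'n::{finite,linorder} \<Rightarrow> nat) = {1..CARD('n)}"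
proof (rule card_subset_eq)
  show "range (pos :: 'n \<Rightarrow> nat) \<subseteq> {1..CARD('n)}"
    by (auto simp: pos_def Suc_le_eq card_gt_0_iff intro!: card_mono)
  show "card (range (pos :: 'n \<Rightarrow> nat)) = card {1..CARD('n)}"
    by (simp add: card_image inj_pos)
qed simp

lemma pos_idx: "i \<in> {1..CARD('n)} \<Longrightarrow> pos (idx i :: 'n::{finite,linorder}) = i"
  unfolding idx_def using range_pos[where 'n='n] by (metis f_inv_into_f)

lemma idx_pos: "idx (pos k) = k"
  unfolding idx_def by (simp add: inj_pos)

lemma coord_mkvec:
  "i \<in> {1..CARD('n)} \<Longrightarrow> (mkvec g :: 'a^'n::{finite,linorder}) $$ i = g i"
  by (simp add: coord_def mkvec_def pos_idx)

text \<open>Smoothness is meant on open sets only.\<close>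

fun Ck_on :: "nat \<Rightarrow> 'a::real_normed_vector set \<Rightarrow> ('a \<Rightarrow> 'b::real_normed_vector) \<Rightarrow> bool" where
  "Ck_on 0 S F \<longleftrightarrow> continuous_on S F"
| "Ck_on (Suc m) S F \<longleftrightarrow>
     (\<forall>x\<in>S. F differentiable (at x)) \<and>
     (\<forall>u. Ck_on m S (\<lambda>x. frechet_derivative F (at x) u))"

definition smooth_on :: "'a::real_normed_vector set \<Rightarrow> ('a \<Rightarrow> 'b::real_normed_vector) \<Rightarrow> bool"
  where "smooth_on S F \<longleftrightarrow> (\<forall>m. Ck_on m S F)"

definition diffeo_on :: "'a::real_normed_vector set \<Rightarrow> ('a \<Rightarrow> 'b::real_normed_vector) \<Rightarrow> bool"
  where "diffeo_on S T \<longleftrightarrow>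
    open S \<and> open (T ` S) \<and> inj_on T S \<and> smooth_on S T \<and> smooth_on (T ` S) (inv_into S T)"

definition partial :: "nat \<Rightarrow> ('n::{finite,linorder} rvec \<Rightarrow> 'b::real_normed_vector) \<Rightarrow>
    'n rvec \<Rightarrow> 'b"
  where "partial i F x = frechet_derivative F (at x) (axis (idx i) 1)"

definition lie :: "('a::real_normed_vector \<Rightarrow> 'a) \<Rightarrow> ('a \<Rightarrow> real) \<Rightarrow> 'a \<Rightarrow> real"
  where "lie f g \<xi> = frechet_derivative g (at \<xi>) (f \<xi>)"

definition covector :: "('n::{finite,linorder} rvec \<Rightarrow> real) \<Rightarrow> 'n rvec \<Rightarrow> 'n rvec"
  where "covector g \<xi> = mkvec (\<lambda>i. partial i g \<xi>)"

definition sidx :: "nat \<Rightarrow> nat \<Rightarrow> nat"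
  where "sidx v i = (i - 1) * v + 1"

definition blk :: "nat \<Rightarrow> nat \<Rightarrow> nat"
  where "blk v i = nat \<lceil>real i / real v\<rceil>"

definition hat :: "nat \<Rightarrow> nat \<Rightarrow> nat"
  where "hat v i = i - sidx v (blk v i)"

definition first_block :: "nat \<Rightarrow> 'n::{finite,linorder} rvec \<Rightarrow> 'w::{finite,linorder} rvec"
  where "first_block v x = mkvec (\<lambda>k. x $$ sidx v k)"

text \<open>The state $(c,0,\ldots,0)$, i.e. $x_{s_k} = c_k$ and all other components zero.\<close>

definition zero_ext :: "nat \<Rightarrow> 'w::{finite,linorder} rvec \<Rightarrow> 'n::{finite,linorder} rvec"
  where "zero_ext v c = mkvec (\<lambda>i. if hat v i = 0 then c $$ blk v i else 0)"

definition keep_first :: "nat \<Rightarrow> 'w::{finite,linorder} rvec \<Rightarrow> 'w rvec"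
  where "keep_first j c = mkvec (\<lambda>k. if k \<le> j then c $$ k else 0)"

definition set_comp :: "nat \<Rightarrow> real \<Rightarrow> 'w::{finite,linorder} rvec \<Rightarrow> 'w rvec"
  where "set_comp j s c = mkvec (\<lambda>k. if k = j then s else c $$ k)"

text \<open>
  The right-hand side of $\dot x_j = x_{j+1}$ ($j < v$), $\dot x_v = p(x)$, with the
  components numbered as in $x_{s_k+\ell}$.
\<close>

definition high_order_field :: "nat \<Rightarrow> ('n::{finite,linorder} rvec \<Rightarrow> 'w::{finite,linorder} rvec) \<Rightarrow>
    'n rvec \<Rightarrow> 'n rvec"
  where "high_order_field v p x =
    mkvec (\<lambda>i. if hat v i < v - 1 then x $$ (i + 1) else p x $$ blk v i)"

definition total_D :: "nat \<Rightarrow> ('n::{finite,linorder} rvec \<Rightarrow> 'w::{finite,linorder} rvec) \<Rightarrow>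
    'n rvec \<Rightarrow> 'w rvec"
  where "total_D v F x =
    (\<Sum>k = 1..CARD('w). \<Sum>l = 1..v - 1. x $$ (sidx v k + l) *\<^sub>R partial (sidx v k + l - 1) F x)"

definition fully_measured_form :: "nat \<Rightarrow> 'n::{finite,linorder} rvec set \<Rightarrow>
    ('n rvec \<Rightarrow> 'w::{finite,linorder} rvec) \<Rightarrow> (nat \<Rightarrow> 'w rvec \<Rightarrow> 'w rvec) \<Rightarrow> bool"
  where "fully_measured_form v W p B \<longleftrightarrow>
    (\<forall>x\<in>W. p x = (\<Sum>r = 0..v - 1. (total_D v ^^ r) (\<lambda>\<xi>. B r (first_block v \<xi>)) x))"

definition given_by_integrals :: "nat \<Rightarrow> 'n::{finite,linorder} rvec set \<Rightarrow>
    ('n rvec \<Rightarrow> 'w::{finite,linorder} rvec) \<Rightarrow> (nat \<Rightarrow> 'w rvec \<Rightarrow> 'w rvec) \<Rightarrow> bool"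
  where "given_by_integrals v W p B \<longleftrightarrow>
    (\<forall>c \<in> first_block v ` W.
       B 0 c = p (zero_ext v c) \<and>
       (\<forall>r \<in> {1..v - 1}. \<forall>k \<in> {1..CARD('w)}.
          B r c $$ k =
            (\<Sum>j = 1..CARD('w). LBINT s=0..c $$ j.
               partial (sidx v j + r) (\<lambda>x. p x $$ k)
                 (zero_ext v (set_comp j s (keep_first j c))))))"

definition pascal_hessian :: "nat \<Rightarrow> 'n::{finite,linorder} rvec set \<Rightarrow>
    ('n rvec \<Rightarrow> 'w::{finite,linorder} rvec) \<Rightarrow> bool"
  where "pascal_hessian v W p \<longleftrightarrow>
    (\<forall>x\<in>W. \<forall>k \<in> {1..CARD('w)}. \<forall>i \<in> {1..CARD('n)}. \<forall>j \<in> {1..CARD('n)}.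
       partial i (partial j (\<lambda>\<xi>. p \<xi> $$ k)) x =
         (if hat v i + hat v j \<le> v - 1
          then real ((hat v i + hat v j) choose hat v i) *
               partial (sidx v (blk v i))
                 (partial (sidx v (blk v j) + hat v i + hat v j) (\<lambda>\<xi>. p \<xi> $$ k)) x
          else 0))"

text \<open>
  $A = I_\omega \otimes A_0$ and $C = I_\omega \otimes C_0$; the rows and columns of
  $A_0$ and $C_0$ are numbered from 0 by \<open>hat v\<close>.
\<close>

definition A0 :: "nat \<Rightarrow> nat \<Rightarrow> real"
  where "A0 i j = (if i = j + 1 then 1 else 0)"

definition C0 :: "nat \<Rightarrow> nat \<Rightarrow> real"
  where "C0 v j = (if j = v - 1 then 1 else 0)"

definition ocf_A :: "nat \<Rightarrow> ('n::{finite,linorder} rvec, 'n) vec"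
  where "ocf_A v =
    mkvec (\<lambda>i. mkvec (\<lambda>j. if blk v i = blk v j then A0 (hat v i) (hat v j) else 0))"

definition ocf_C :: "nat \<Rightarrow> ('n::{finite,linorder} rvec, 'w::{finite,linorder}) vec"
  where "ocf_C v = mkvec (\<lambda>k. mkvec (\<lambda>j. if k = blk v j then C0 v (hat v j) else 0))"

definition transformable_to_ocf :: "nat \<Rightarrow> 'n::{finite,linorder} rvec set \<Rightarrow>
    ('n rvec \<Rightarrow> 'n rvec) \<Rightarrow> ('n rvec \<Rightarrow> 'w::{finite,linorder} rvec) \<Rightarrow> bool"
  where "transformable_to_ocf v W f h \<longleftrightarrow>
    (\<exists>(T :: 'n rvec \<Rightarrow> 'n rvec) (\<alpha> :: 'w rvec \<Rightarrow> 'n rvec).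
       diffeo_on W T \<and> open (h ` W) \<and> smooth_on (h ` W) \<alpha> \<and>
       (\<forall>x\<in>W. frechet_derivative T (at x) (f x) = ocf_A v *v T x + \<alpha> (h x) \<and>
               h x = ocf_C v *v T x))"

text \<open>
  Conditions on a region that the integral formulas and the claim need implicitly: all points at
  which \<open>p\<close> and its derivatives are evaluated lie in the region (taking the last \<open>j\<close> with
  \<open>s = c $$ j\<close>, this includes $(x_1,0,\ldots,0)$), and the slices $x_1 = $ const are connected.
\<close>

definition admissible_region ::
    "nat \<Rightarrow> 'w::{finite,linorder} itself \<Rightarrow> 'n::{finite,linorder} rvec set \<Rightarrow> bool"
  where "admissible_region v _ W \<longleftrightarrow>
    (\<forall>c \<in> (first_block v ` W :: 'w rvec set). \<forall>j \<in> {1..CARD('w)}.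
       \<forall>s \<in> closed_segment 0 (c $$ j). zero_ext v (set_comp j s (keep_first j c)) \<in> W) \<and>
    (\<forall>c :: 'w rvec. connected {x \<in> W. first_block v x = c})"

end

theory Submission
  imports Defs
begin

text \<open>
  The operator $D$ raises derivative orders by one, so for a smooth function $\beta$ of the outputs
  alone $\partial(D^r\beta)/\partial x_{s_k+l} = \binom{r}{l} D^{r-l}\,\partial\beta/\partial x_{s_k}$.
  The Pascal-Hessian condition for $\sum_r D^r B_r$ is then the identity
  $\binom{r}{j}\binom{r-j}{i} = \binom{r}{i+j}\binom{i+j}{i}$. Conversely, the condition makes each
  1-form $\sum_j \partial p_k/\partial x_{s_j+r}\,dx_{s_j}$ on the zero section closed, so
  that $B_{k,r}$, its integral along an axis-parallel polyline, is a potential. By downward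
  induction on $r$ the defect $p - \sum_r D^r B_r$ has no derivatives in the higher blocks, and it
  vanishes on the zero section. The observer form is reached by subtracting
  $\sum_{i=1}^m D^{m-i} B_{v-i}$ from the $m$-th output derivative, a strictly block-triangular
  change of coordinates.
\<close>

section \<open>Directional derivatives and smooth functions\<close>

text \<open>The induction on r runs downwards because the Pascal-Hessian condition turns the
  derivative of \<open>pd a r q\<close> along \<open>unit_vec b l\<close> with \<open>l > 0\<close>
  into 0 or a multiple of \<open>pd b 0 (pd a (l + r) q)\<close>: only larger indices occur.
  Vanishing derivatives along the higher blocks give constancy only on connected slices of fixed
  outputs; admissibility makes each nonempty slice meet the zero section, where every D^r F with r >
  0 vanishes, since the coefficients of D are the components x_(s_k+l) with l > 0. The region need
  not be a product, so it is the wrong domain for inverting the change of coordinates: the inverting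
  iteration preserves the outputs but need not stay in the region. It is carried out on the cylinder
  of all states over the output set instead. The integrals defining B_r have limits that move with
  the point. Rescaling each leg to [0,1] allows differentiation under the integral sign, which
  yields derivatives along lines; continuity of the resulting gradient upgrades them to Frechet
  derivatives.\<close>

definition ddir :: "'a::real_normed_vector \<Rightarrow> ('a \<Rightarrow> 'b::real_normed_vector) \<Rightarrow> 'a \<Rightarrow> 'b"
  where "ddir u F x = frechet_derivative F (at x) u"

lemma has_derivative_ddir:
  "F differentiable (at x) \<Longrightarrow> (F has_derivative (\<lambda>u. ddir u F x)) (at x)"
  by (simp add: ddir_def frechet_derivative_works)

lemma ddir_eq: "(F has_derivative F') (at x) \<Longrightarrow> ddir u F x = F' u"
  by (metis ddir_def frechet_derivative_at)

lemma linear_ddir: "F differentiable (at x) \<Longrightarrow> linear (\<lambda>u. ddir u F x)"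
  using has_derivative_ddir has_derivative_linear by blast

lemma ddir_const [simp]: "ddir u (\<lambda>x. c) x = 0"
  by (simp add: ddir_def)

lemma ddir_bounded_linear: "bounded_linear L \<Longrightarrow> ddir u L x = L u"
  by (intro ddir_eq bounded_linear_imp_has_derivative)

lemma ddir_linear_compose:
  assumes "bounded_linear L" "F differentiable (at x)"
  shows "ddir u (\<lambda>x. L (F x)) x = L (ddir u F x)"
  by (rule ddir_eq[OF bounded_linear.has_derivative[OF assms(1) has_derivative_ddir[OF assms(2)]]])

lemma ddir_add:
  assumes "F differentiable (at x)" "G differentiable (at x)"
  shows "ddir u (\<lambda>x. F x + G x) x = ddir u F x + ddir u G x"
  by (rule ddir_eq[OF has_derivative_add[OF assms[THEN has_derivative_ddir]]])

lemma ddir_diff: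
  assumes "F differentiable (at x)" "G differentiable (at x)"
  shows "ddir u (\<lambda>x. F x - G x) x = ddir u F x - ddir u G x"
  by (rule ddir_eq[OF has_derivative_diff[OF assms[THEN has_derivative_ddir]]])

lemma ddir_sum:
  assumes "\<And>i. i \<in> I \<Longrightarrow> F i differentiable (at x)"
  shows "ddir u (\<lambda>x. \<Sum>i\<in>I. F i x) x = (\<Sum>i\<in>I. ddir u (F i) x)"
  by (rule ddir_eq[OF has_derivative_sum[OF assms[THEN has_derivative_ddir]]])

lemma (in bounded_bilinear) ddir:
  assumes "F differentiable (at x)" "G differentiable (at x)"
  shows "ddir u (\<lambda>x. prod (F x) (G x)) x = prod (F x) (ddir u G x) + prod (ddir u F x) (G x)"
  by (rule ddir_eq[OF FDERIV[OF assms[THEN has_derivative_ddir]]])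

lemmas ddir_scaleR = bounded_bilinear.ddir[OF bounded_bilinear_scaleR]

lemma has_derivative_cong_open:
  assumes "open S" "x \<in> S" "\<And>y. y \<in> S \<Longrightarrow> F y = G y"
  shows "(F has_derivative D) (at x) \<longleftrightarrow> (G has_derivative D) (at x)"
proof
  show "(G has_derivative D) (at x)" if "(F has_derivative D) (at x)"
    using that assms by (rule has_derivative_transform_within_open)
  show "(F has_derivative D) (at x)" if "(G has_derivative D) (at x)"
    using that assms(1,2) assms(3)[symmetric] by (rule has_derivative_transform_within_open)
qed

text \<open>\<open>frechet_derivative\<close> is a choice from the set of all derivatives at the
  point, and this set is the same for both functions, so the values agree even at points of
  non-differentiability.\<close>

lemma ddir_cong:
  assumes "open S" "x \<in> S" "\<And>y. y \<in> S \<Longrightarrow> F y = G y"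
  shows "ddir u F x = ddir u G x"
  by (simp add: ddir_def frechet_derivative_def has_derivative_cong_open[OF assms])

lemma differentiable_cong_open:
  assumes "open S" "x \<in> S" "\<And>y. y \<in> S \<Longrightarrow> F y = G y"
  shows "F differentiable (at x) \<longleftrightarrow> G differentiable (at x)"
  by (simp add: differentiable_def has_derivative_cong_open[OF assms])

section \<open>Calculus of \<open>Ck_on\<close> and \<open>smooth_on\<close>\<close>

lemma Ck_on_Suc:
  "Ck_on (Suc m) S F \<longleftrightarrow> (\<forall>x\<in>S. F differentiable (at x)) \<and> (\<forall>u. Ck_on m S (ddir u F))"
  by (simp add: ddir_def[abs_def])

declare Ck_on.simps(2)[simp del]

lemma Ck_on_SucD: "Ck_on (Suc m) S F \<Longrightarrow> Ck_on m S F"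
proof (induction m arbitrary: F)
  case 0
  then show ?case
    by (auto simp: Ck_on_Suc intro: differentiable_imp_continuous_within continuous_at_imp_continuous_on)
next
  case (Suc m)
  then show ?case
    by (subst Ck_on_Suc) (auto simp: Ck_on_Suc[of "Suc m"])
qed

lemma Ck_on_cong:
  assumes "open S" "\<And>y. y \<in> S \<Longrightarrow> F y = G y"
  shows "Ck_on m S F \<longleftrightarrow> Ck_on m S G"
  using assms(2)
proof (induction m arbitrary: F G)
  case 0
  then show ?case by (simp cong: continuous_on_cong)
next
  case (Suc m)
  have "Ck_on m S (ddir u F) \<longleftrightarrow> Ck_on m S (ddir u G)" for u
    by (intro Suc.IH ddir_cong[OF assms(1)] Suc.prems)
  then show ?case
    using differentiable_cong_open[OF assms(1) _ Suc.prems] by (simp add: Ck_on_Suc)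
qed

lemma Ck_on_const: "Ck_on m S (\<lambda>x. c)"
proof (induction m arbitrary: c)
  case (Suc m)
  have "ddir u (\<lambda>x. c) = (\<lambda>x::'a. 0)" for u
    by (simp add: ddir_def fun_eq_iff)
  with Suc show ?case by (simp add: Ck_on_Suc)
qed simp

lemma Ck_on_bounded_linear:
  assumes "bounded_linear L"
  shows "Ck_on m S L"
proof (cases m)
  case 0
  then show ?thesis using assms by (simp add: linear_continuous_on)
next
  case (Suc k)
  have "ddir u L = (\<lambda>x. L u)" for u
    by (auto intro!: ddir_eq bounded_linear_imp_has_derivative assms)
  then show ?thesis
    using assms Suc by (simp add: Ck_on_Suc Ck_on_const bounded_linear_imp_differentiable)
qed

lemma Ck_on_add:
  assumes "open S" "Ck_on m S F" "Ck_on m S G"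
  shows "Ck_on m S (\<lambda>x. F x + G x)"
  using assms(2,3)
proof (induction m arbitrary: F G)
  case (Suc m)
  have "ddir u (\<lambda>x. F x + G x) x = ddir u F x + ddir u G x" if "x \<in> S" for u x
    using Suc.prems that by (simp add: Ck_on_Suc ddir_add)
  then have "Ck_on m S (ddir u (\<lambda>x. F x + G x)) \<longleftrightarrow> Ck_on m S (\<lambda>x. ddir u F x + ddir u G x)" for u
    by (intro Ck_on_cong assms)
  with Suc show ?case by (simp add: Ck_on_Suc)
qed (simp add: continuous_on_add)

lemma Ck_on_sum:
  assumes "open S" "\<And>i. i \<in> I \<Longrightarrow> Ck_on m S (F i)"
  shows "Ck_on m S (\<lambda>x. \<Sum>i\<in>I. F i x)"
  using assms(2)
  by (induction I rule: infinite_finite_induct) (auto intro!: Ck_on_const Ck_on_add assms(1))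

text \<open>The product rule pairs a derivative with an undifferentiated factor;
  \<open>Ck_on_SucD\<close> lowers the latter to the same order so that the induction hypothesis
  applies to both summands.\<close>

lemma (in bounded_bilinear) Ck_on:
  assumes "open S" "Ck_on m S F" "Ck_on m S G"
  shows "Ck_on m S (\<lambda>x. prod (F x) (G x))"
  using assms(2,3)
proof (induction m arbitrary: F G)
  case 0
  then show ?case by (simp add: continuous_on)
next
  case (Suc m)
  have eq: "ddir u (\<lambda>x. prod (F x) (G x)) x = prod (F x) (ddir u G x) + prod (ddir u F x) (G x)"
    if "x \<in> S" for u x
    using Suc.prems that by (simp add: Ck_on_Suc ddir)
  have "Ck_on m S (ddir u (\<lambda>x. prod (F x) (G x)))" for u
    using Ck_on_cong[OF assms(1) eq] Suc.IH Suc.prems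
    by (simp add: Ck_on_add[OF assms(1)] Ck_on_Suc Ck_on_SucD)
  moreover have "(\<lambda>x. prod (F x) (G x)) differentiable (at x)" if "x \<in> S" for x
    using FDERIV[OF has_derivative_ddir has_derivative_ddir, of F x G] Suc.prems that
    by (auto simp: differentiable_def Ck_on_Suc)
  ultimately show ?case by (simp add: Ck_on_Suc)
qed

text \<open>In the first form the direction \<open>ddir u G x\<close> moves with \<open>x\<close>,
  whereas \<open>Ck_on\<close> only speaks of fixed directions. The second form expands it in the
  basis and so yields sums of products of functions that the induction in
  \<open>Ck_on_compose\<close> can handle.\<close>

lemma ddir_compose:
  fixes G :: "'a::real_normed_vector \<Rightarrow> 'b::euclidean_space"
  assumes "G differentiable (at x)" "F differentiable (at (G x))"
  shows "ddir u (\<lambda>x. F (G x)) x = ddir (ddir u G x) F (G x)"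
    and "ddir u (\<lambda>x. F (G x)) x = (\<Sum>b\<in>Basis. (ddir u G x \<bullet> b) *\<^sub>R ddir b F (G x))"
proof -
  show 1: "ddir u (\<lambda>x. F (G x)) x = ddir (ddir u G x) F (G x)"
    using diff_chain_at[OF has_derivative_ddir[OF assms(1)] has_derivative_ddir[OF assms(2)]]
    using ddir_eq by (fastforce simp: o_def)
  also have "\<dots> = ddir (\<Sum>b\<in>Basis. (ddir u G x \<bullet> b) *\<^sub>R b) F (G x)"
    by (simp add: euclidean_representation)
  also have "\<dots> = (\<Sum>b\<in>Basis. (ddir u G x \<bullet> b) *\<^sub>R ddir b F (G x))"
    using linear_ddir[OF assms(2)]
    by (simp add: linear_sum[of "\<lambda>u. ddir u F (G x)"] linear_scale[of "\<lambda>u. ddir u F (G x)"])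
  finally show "ddir u (\<lambda>x. F (G x)) x = (\<Sum>b\<in>Basis. (ddir u G x \<bullet> b) *\<^sub>R ddir b F (G x))" .
qed

lemma Ck_on_compose:
  fixes G :: "'a::real_normed_vector \<Rightarrow> 'b::euclidean_space"
  assumes "open S" "G ` S \<subseteq> T" "Ck_on m T F" "Ck_on m S G"
  shows "Ck_on m S (\<lambda>x. F (G x))"
  using assms(3,4)
proof (induction m arbitrary: F)
  case 0
  then show ?case using assms(2) by (auto intro: continuous_on_compose2)
next
  case (Suc m)
  have d: "G differentiable (at x)" "F differentiable (at (G x))" if "x \<in> S" for x
    using Suc.prems that assms(2) by (auto simp: Ck_on_Suc)
  have sub: "Ck_on m T (ddir b F)" "Ck_on m S (ddir u G)" "Ck_on m S G" for b u
    using Suc.prems Ck_on_SucD[of m S G] by (auto simp: Ck_on_Suc)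
  have "Ck_on m S (\<lambda>x. \<Sum>b\<in>Basis. (ddir u G x \<bullet> b) *\<^sub>R ddir b F (G x))" for u
    by (intro Ck_on_sum assms bounded_bilinear.Ck_on[OF bounded_bilinear_scaleR]
        bounded_bilinear.Ck_on[OF bounded_bilinear_inner] Ck_on_const Suc.IH sub)
  then have "Ck_on m S (ddir u (\<lambda>x. F (G x)))" for u
    using Ck_on_cong[OF assms(1) ddir_compose(2)[OF d]] by simp
  then show ?case
    using differentiable_chain_at[OF d] by (auto simp: Ck_on_Suc o_def)
qed

text \<open>Serves to prove smoothness of a function known only through its derivative, such as a
  path integral.\<close>

lemma smooth_on_iff:
  "smooth_on S F \<longleftrightarrow> (\<forall>x\<in>S. F differentiable (at x)) \<and> (\<forall>u. smooth_on S (ddir u F))"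
proof
  assume "smooth_on S F"
  then have F: "Ck_on (Suc m) S F" for m by (simp add: smooth_on_def)
  show "(\<forall>x\<in>S. F differentiable (at x)) \<and> (\<forall>u. smooth_on S (ddir u F))"
    using F by (simp add: smooth_on_def Ck_on_Suc)
next
  assume F: "(\<forall>x\<in>S. F differentiable (at x)) \<and> (\<forall>u. smooth_on S (ddir u F))"
  then have "Ck_on (Suc m) S F" for m
    by (simp add: smooth_on_def Ck_on_Suc)
  then show "smooth_on S F"
    using Ck_on_SucD[of _ S F] by (simp add: smooth_on_def)
qed

lemma smooth_on_differentiable: "smooth_on S F \<Longrightarrow> x \<in> S \<Longrightarrow> F differentiable (at x)"
  using smooth_on_iff[of S F] by blast

lemma smooth_on_ddir: "smooth_on S F \<Longrightarrow> smooth_on S (ddir u F)"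
  using smooth_on_iff[of S F] by blast

lemma smooth_on_continuous_on: "smooth_on S F \<Longrightarrow> continuous_on S F"
  unfolding smooth_on_def using Ck_on.simps(1)[of S F] by blast

lemma smooth_on_cong:
  assumes "open S" "\<And>y. y \<in> S \<Longrightarrow> F y = G y"
  shows "smooth_on S F \<longleftrightarrow> smooth_on S G"
  by (simp add: smooth_on_def Ck_on_cong[OF assms])

lemma Ck_on_subset: "Ck_on m T F \<Longrightarrow> S \<subseteq> T \<Longrightarrow> Ck_on m S F"
  by (induction m arbitrary: F) (auto simp: Ck_on_Suc intro: continuous_on_subset)

lemma smooth_on_subset: "smooth_on T F \<Longrightarrow> S \<subseteq> T \<Longrightarrow> smooth_on S F"
  unfolding smooth_on_def using Ck_on_subset by blast

lemma smooth_on_const: "smooth_on S (\<lambda>x. c)"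
  by (simp add: smooth_on_def Ck_on_const)

lemma smooth_on_bounded_linear: "bounded_linear L \<Longrightarrow> smooth_on S L"
  by (simp add: smooth_on_def Ck_on_bounded_linear)

lemma smooth_on_add:
  "open S \<Longrightarrow> smooth_on S F \<Longrightarrow> smooth_on S G \<Longrightarrow> smooth_on S (\<lambda>x. F x + G x)"
  by (simp add: smooth_on_def Ck_on_add)

lemma smooth_on_sum:
  "open S \<Longrightarrow> (\<And>i. i \<in> I \<Longrightarrow> smooth_on S (F i)) \<Longrightarrow> smooth_on S (\<lambda>x. \<Sum>i\<in>I. F i x)"
  by (simp add: smooth_on_def Ck_on_sum)

lemma (in bounded_bilinear) smooth_on:
  "open S \<Longrightarrow> smooth_on S F \<Longrightarrow> smooth_on S G \<Longrightarrow> smooth_on S (\<lambda>x. prod (F x) (G x))"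
  by (simp add: smooth_on_def Ck_on)

lemmas smooth_on_scaleR = bounded_bilinear.smooth_on[OF bounded_bilinear_scaleR]

lemma smooth_on_compose:
  fixes G :: "'a::real_normed_vector \<Rightarrow> 'b::euclidean_space"
  shows "open S \<Longrightarrow> smooth_on T F \<Longrightarrow> smooth_on S G \<Longrightarrow> G ` S \<subseteq> T \<Longrightarrow> smooth_on S (\<lambda>x. F (G x))"
  by (auto simp: smooth_on_def intro: Ck_on_compose)

lemma smooth_on_linear_compose:
  fixes F :: "'a::real_normed_vector \<Rightarrow> 'b::euclidean_space"
  shows "open S \<Longrightarrow> bounded_linear L \<Longrightarrow> smooth_on S F \<Longrightarrow> smooth_on S (\<lambda>x. L (F x))"
  using smooth_on_compose smooth_on_bounded_linear by blast

lemma smooth_on_diff: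
  assumes "open S" "smooth_on S F" "smooth_on S G"
  shows "smooth_on S (\<lambda>x. F x - G x)"
  using smooth_on_add[OF assms(1,2) smooth_on_scaleR[OF assms(1) smooth_on_const assms(3)], of "-1"]
  by simp

section \<open>Symmetry of second directional derivatives\<close>

lemma has_real_derivative_along_line:
  fixes F :: "'a::real_normed_vector \<Rightarrow> real"
  assumes "F differentiable (at (x + t *\<^sub>R u))"
  shows "((\<lambda>t. F (x + t *\<^sub>R u)) has_real_derivative ddir u F (x + t *\<^sub>R u)) (at t)"
proof -
  have "((\<lambda>t. x + t *\<^sub>R u) has_derivative (\<lambda>s. s *\<^sub>R u)) (at t)"
    by (auto intro!: derivative_eq_intros)
  from diff_chain_at[OF this has_derivative_ddir[OF assms]]
  have "((\<lambda>t. F (x + t *\<^sub>R u)) has_derivative (\<lambda>s. ddir (s *\<^sub>R u) F (x + t *\<^sub>R u))) (at t)"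
    by (simp add: o_def)
  moreover have "(\<lambda>s. ddir (s *\<^sub>R u) F (x + t *\<^sub>R u)) = (*) (ddir u F (x + t *\<^sub>R u))"
    using linear_scale[OF linear_ddir[OF assms]] by (auto simp: mult.commute)
  ultimately show ?thesis
    by (simp only: has_field_derivative_def)
qed

text \<open>Two mean value steps: one along \<open>u\<close> for the difference of the values at
  \<open>x + s *\<^sub>R w\<close> and at \<open>x\<close>, one along \<open>w\<close> for
  \<open>ddir u F\<close>. The second difference is symmetric in \<open>u\<close> and
  \<open>w\<close> while the right-hand side is not, which is what makes it useful.\<close>

lemma second_difference_mvt:
  fixes F :: "'a::real_normed_vector \<Rightarrow> real"
  assumes F: "smooth_on S F" and S: "ball x r \<subseteq> S" and s: "0 < s" "s * (norm u + norm w) < r"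
  obtains y where "dist x y \<le> s * (norm u + norm w)"
    "F (x + s *\<^sub>R w + s *\<^sub>R u) - F (x + s *\<^sub>R u) - F (x + s *\<^sub>R w) + F x = s^2 * ddir w (ddir u F) y"
proof -
  have inS: "x + a *\<^sub>R w + b *\<^sub>R u \<in> S \<and> dist x (x + a *\<^sub>R w + b *\<^sub>R u) \<le> s * (norm u + norm w)"
    if "0 \<le> a" "a \<le> s" "0 \<le> b" "b \<le> s" for a b
  proof -
    have "norm (- (a *\<^sub>R w + b *\<^sub>R u)) \<le> a * norm w + b * norm u"
      unfolding norm_minus_cancel using norm_triangle_ineq[of "a *\<^sub>R w" "b *\<^sub>R u"] that by simp
    also have "\<dots> \<le> s * norm w + s * norm u"
      using that by (intro add_mono mult_right_mono) auto
    finally have "dist x (x + a *\<^sub>R w + b *\<^sub>R u) \<le> s * (norm u + norm w)"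
      by (simp add: dist_norm add.assoc distrib_left)
    then show ?thesis using S s by (auto simp: subset_iff)
  qed
  note dF = smooth_on_differentiable[OF F] smooth_on_differentiable[OF smooth_on_ddir[OF F, of u]]
  have "((\<lambda>b. F (x + s *\<^sub>R w + b *\<^sub>R u) - F (x + b *\<^sub>R u)) has_real_derivative
      ddir u F (x + s *\<^sub>R w + b *\<^sub>R u) - ddir u F (x + b *\<^sub>R u)) (at b)" if "0 \<le> b" "b \<le> s" for b
    using inS[of s b] inS[of 0 b] that s
    by (intro DERIV_diff has_real_derivative_along_line dF) auto
  from MVT2[OF s(1) this] obtain b where b: "0 < b" "b < s" and
    eq1: "F (x + s *\<^sub>R w + s *\<^sub>R u) - F (x + s *\<^sub>R u) - (F (x + s *\<^sub>R w) - F x) =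
      s * (ddir u F (x + s *\<^sub>R w + b *\<^sub>R u) - ddir u F (x + b *\<^sub>R u))"
    by auto
  have "((\<lambda>a. ddir u F (x + b *\<^sub>R u + a *\<^sub>R w)) has_real_derivative
      ddir w (ddir u F) (x + b *\<^sub>R u + a *\<^sub>R w)) (at a)" if "0 \<le> a" "a \<le> s" for a
    using inS[of a b] that b
    by (intro has_real_derivative_along_line dF) (auto simp: algebra_simps)
  from MVT2[OF s(1) this] obtain a where a: "0 < a" "a < s" and
    eq2: "ddir u F (x + b *\<^sub>R u + s *\<^sub>R w) - ddir u F (x + b *\<^sub>R u) =
      s * ddir w (ddir u F) (x + b *\<^sub>R u + a *\<^sub>R w)"
    by auto
  show thesis
  proof
    show "dist x (x + a *\<^sub>R w + b *\<^sub>R u) \<le> s * (norm u + norm w)"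
      using inS[of a b] a b by auto
    show "F (x + s *\<^sub>R w + s *\<^sub>R u) - F (x + s *\<^sub>R u) - F (x + s *\<^sub>R w) + F x =
        s^2 * ddir w (ddir u F) (x + a *\<^sub>R w + b *\<^sub>R u)"
      using eq1 eq2 by (simp add: power2_eq_square add_ac)
  qed
qed

text \<open>Both orders of differentiation, taken at suitable points near \<open>x\<close>, equal
  the same second difference divided by \<open>s^2\<close>; continuity carries the equality to
  \<open>x\<close>.\<close>

lemma ddir_commute_real:
  fixes F :: "'a::real_normed_vector \<Rightarrow> real"
  assumes "open S" "smooth_on S F" "x \<in> S"
  shows "ddir w (ddir u F) x = ddir u (ddir w F) x"
proof (rule ccontr)
  \<comment> \<open>Half the gap: two numbers strictly within \<open>e\<close> of the two
    derivatives cannot be equal.\<close>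
  define e where "e = \<bar>ddir w (ddir u F) x - ddir u (ddir w F) x\<bar> / 2"
  assume "ddir w (ddir u F) x \<noteq> ddir u (ddir w F) x"
  then have e: "e > 0" by (simp add: e_def)
  obtain r where r: "r > 0" "ball x r \<subseteq> S"
    using assms openE by blast
  have c: "continuous (at x) (ddir a (ddir b F))" for a b
    using smooth_on_continuous_on[OF smooth_on_ddir[OF smooth_on_ddir[OF assms(2)]]] assms(1,3)
    by (simp add: continuous_on_eq_continuous_at)
  obtain d1 where d1: "d1 > 0" "\<And>y. dist y x < d1 \<Longrightarrow> dist (ddir w (ddir u F) y) (ddir w (ddir u F) x) < e"
    using c[of w u] e unfolding continuous_at_eps_delta by blast
  obtain d2 where d2: "d2 > 0" "\<And>y. dist y x < d2 \<Longrightarrow> dist (ddir u (ddir w F) y) (ddir u (ddir w F) x) < e"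
    using c[of u w] e unfolding continuous_at_eps_delta by blast
  define d where "d = min r (min d1 d2)"
  \<comment> \<open>The summand 1 keeps the denominator positive for \<open>u = w = 0\<close>; the
    factor 2 makes the bound by \<open>d\<close> strict.\<close>
  define s where "s = d / (2 * (norm u + norm w + 1))"
  have d: "d > 0" using r d1 d2 by (simp add: d_def)
  have nn: "norm u + norm w + 1 > 0" by (simp add: add_nonneg_pos)
  have "s * (norm u + norm w) \<le> s * (norm u + norm w + 1)"
    using d nn by (intro mult_left_mono) (auto simp: s_def)
  also have "\<dots> = d / 2" using nn by (simp add: s_def field_simps)
  finally have "s * (norm u + norm w) \<le> d / 2" .
  moreover have "s > 0"
    using d nn unfolding s_def by (intro divide_pos_pos mult_pos_pos) simp_all
  ultimately have s: "s > 0" "s * (norm u + norm w) < d"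
    using d by linarith+
  then have s': "s * (norm u + norm w) < r" "s * (norm w + norm u) < r"
    by (auto simp: d_def add.commute)
  obtain y where y: "dist x y \<le> s * (norm u + norm w)"
    "F (x + s *\<^sub>R w + s *\<^sub>R u) - F (x + s *\<^sub>R u) - F (x + s *\<^sub>R w) + F x = s^2 * ddir w (ddir u F) y"
    using second_difference_mvt[OF assms(2) r(2) s(1) s'(1)] .
  obtain z where z: "dist x z \<le> s * (norm w + norm u)"
    "F (x + s *\<^sub>R u + s *\<^sub>R w) - F (x + s *\<^sub>R w) - F (x + s *\<^sub>R u) + F x = s^2 * ddir u (ddir w F) z"
    using second_difference_mvt[OF assms(2) r(2) s(1) s'(2)] .
  have "s^2 * ddir w (ddir u F) y = s^2 * ddir u (ddir w F) z"
    unfolding y(2)[symmetric] z(2)[symmetric] by (simp add: algebra_simps)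
  then have "ddir w (ddir u F) y = ddir u (ddir w F) z" using s(1) by simp
  moreover have "dist (ddir w (ddir u F) y) (ddir w (ddir u F) x) < e"
    using y(1) s(2) by (intro d1) (auto simp: d_def dist_commute)
  moreover have "dist (ddir u (ddir w F) z) (ddir u (ddir w F) x) < e"
    using z(1) s(2) by (intro d2) (auto simp: d_def dist_commute add.commute)
  ultimately show False
    unfolding e_def dist_real_def by (simp add: abs_if split: if_splits)
qed

lemma ddir_commute:
  fixes F :: "'a::real_normed_vector \<Rightarrow> 'b::euclidean_space"
  assumes S: "open S" "x \<in> S" and F: "smooth_on S F"
  shows "ddir w (ddir u F) x = ddir u (ddir w F) x"
proof (rule euclidean_eqI)
  fix b :: 'b assume "b \<in> Basis"
  have L: "bounded_linear (\<lambda>y. y \<bullet> b)" by (rule bounded_linear_inner_left)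
  have eq: "ddir a (ddir c F) x \<bullet> b = ddir a (ddir c (\<lambda>x. F x \<bullet> b)) x" for a c
  proof -
    have "ddir a (ddir c (\<lambda>x. F x \<bullet> b)) x = ddir a (\<lambda>x. ddir c F x \<bullet> b) x"
      by (intro ddir_cong[OF S] ddir_linear_compose[OF L] smooth_on_differentiable[OF F])
    also have "\<dots> = ddir a (ddir c F) x \<bullet> b"
      by (intro ddir_linear_compose[OF L] smooth_on_differentiable[OF smooth_on_ddir[OF F]] S)
    finally show ?thesis by simp
  qed
  show "ddir w (ddir u F) x \<bullet> b = ddir u (ddir w F) x \<bullet> b"
    unfolding eq by (rule ddir_commute_real[OF S(1) smooth_on_linear_compose[OF S(1) L F] S(2)])
qed

section \<open>Block coordinates and the operator $D$\<close>

text \<open>Only the derivative in the direction of the segment matters. This is applied where the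
  derivatives along some components vanish and the difference of the end points is zero in all the
  others.\<close>

lemma eq_if_ddir_zero_on_segment:
  fixes F :: "'a::real_normed_vector \<Rightarrow> 'b::real_normed_vector"
  assumes "\<And>z. z \<in> closed_segment x y \<Longrightarrow> F differentiable (at z)"
    and "\<And>z. z \<in> closed_segment x y \<Longrightarrow> ddir (y - x) F z = 0"
  shows "F x = F y"
proof -
  let ?g = "\<lambda>t::real. F (x + t *\<^sub>R (y - x))"
  have "(?g has_derivative (\<lambda>h. 0)) (at t within {0..1})" if "t \<in> {0..1}" for t
  proof -
    have z: "x + t *\<^sub>R (y - x) \<in> closed_segment x y"
      using that by (auto simp: in_segment algebra_simps intro!: exI[of _ t])
    have "((\<lambda>t. x + t *\<^sub>R (y - x)) has_derivative (\<lambda>s. s *\<^sub>R (y - x))) (at t)"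
      by (auto intro!: derivative_eq_intros)
    from diff_chain_at[OF this has_derivative_ddir[OF assms(1)[OF z]]]
    have "(?g has_derivative (\<lambda>s. ddir (s *\<^sub>R (y - x)) F (x + t *\<^sub>R (y - x)))) (at t)"
      by (simp add: o_def)
    moreover have "ddir (s *\<^sub>R (y - x)) F (x + t *\<^sub>R (y - x)) = 0" for s
      using linear_scale[OF linear_ddir[OF assms(1)[OF z]]] assms(2)[OF z] by simp
    ultimately show ?thesis
      by (simp add: has_derivative_at_withinI)
  qed
  from has_derivative_zero_unique[OF _ this, of 0 1] show ?thesis by simp
qed

section \<open>Components and the block numbering of indices\<close>

lemma coord_eqI:
  fixes x y :: "'a^'n::{finite,linorder}"
  assumes "\<And>i. i \<in> {1..CARD('n)} \<Longrightarrow> x $$ i = y $$ i"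
  shows "x = y"
proof -
  have "x $ k = y $ k" for k
  proof -
    have "pos k \<in> {1..CARD('n)}" using range_pos[where 'n='n] by blast
    from assms[OF this] show ?thesis by (simp add: coord_def idx_pos)
  qed
  then show ?thesis by (simp add: vec_eq_iff)
qed

lemma idx_eq_iff:
  "i \<in> {1..CARD('n)} \<Longrightarrow> j \<in> {1..CARD('n)} \<Longrightarrow>
    (idx i :: 'n::{finite,linorder}) = idx j \<longleftrightarrow> i = j"
  by (metis pos_idx)

lemma bounded_linear_coord: "bounded_linear (\<lambda>x::'n::{finite,linorder} rvec. x $$ i)"
  unfolding coord_def by (rule bounded_linear_vec_nth)

lemma coord_axis:
  "i \<in> {1..CARD('n)} \<Longrightarrow> j \<in> {1..CARD('n)} \<Longrightarrow>
    (axis (idx i) 1 :: 'n::{finite,linorder} rvec) $$ j = (if i = j then 1 else 0)"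
  by (auto simp: coord_def axis_def idx_eq_iff)

text \<open>The quotient is k - 1 + (l + 1) / v with 0 < l + 1 \<le> v, hence lies in the half-open
  interval from k - 1 to k on which the ceiling is k.\<close>

lemma blk_sidx: "l < v \<Longrightarrow> 1 \<le> k \<Longrightarrow> blk v (sidx v k + l) = k"
proof -
  assume "l < v" "1 \<le> k"
  then have "real (sidx v k + l) = (real k - 1) * real v + real l + 1"
    by (cases k) (simp_all add: sidx_def)
  then have "\<lceil>real (sidx v k + l) / real v\<rceil> = int k"
    using \<open>l < v\<close> by (intro ceiling_unique) (auto simp: field_simps)
  then show ?thesis by (simp add: blk_def)
qed

lemma hat_sidx: "l < v \<Longrightarrow> 1 \<le> k \<Longrightarrow> hat v (sidx v k + l) = l"
  by (simp add: hat_def blk_sidx)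

lemma sidx_in_range: "l < v \<Longrightarrow> k \<in> {1..w} \<Longrightarrow> sidx v k + l \<in> {1..w * v}"
proof -
  assume "l < v" "k \<in> {1..w}"
  then have "(k - 1) * v + (l + 1) \<le> (k - 1) * v + v" by simp
  also have "\<dots> = k * v" using \<open>k \<in> {1..w}\<close> by (cases k) auto
  also have "\<dots> \<le> w * v" using \<open>k \<in> {1..w}\<close> by simp
  finally show ?thesis by (simp add: sidx_def)
qed

lemma sidx_cases:
  assumes "i \<in> {1..w * v}"
  obtains k l where "k \<in> {1..w}" "l < v" "i = sidx v k + l"
proof
  have v: "v > 0" using assms by (cases v) auto
  have "(i - 1) div v < w"
    using assms v by (simp add: less_mult_imp_div_less Suc_le_lessD)
  then show "(i - 1) div v + 1 \<in> {1..w}" by simp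
  show "(i - 1) mod v < v" using v by simp
  show "i = sidx v ((i - 1) div v + 1) + (i - 1) mod v"
    using assms by (simp add: sidx_def)
qed

text \<open>Lets the Hessian of each component be read off from vector-valued second derivatives, so
  that all components of \<open>p\<close> can be treated at once.\<close>

lemma ddir_ddir_coord:
  fixes p :: "'a::real_normed_vector \<Rightarrow> 'm::{finite,linorder} rvec"
  assumes S: "open S" and p: "smooth_on S p" and x: "x \<in> S"
  shows "ddir a (ddir b (\<lambda>x. p x $$ k)) x = ddir a (ddir b p) x $$ k"
proof -
  have "ddir a (ddir b (\<lambda>x. p x $$ k)) x = ddir a (\<lambda>x. ddir b p x $$ k) x"
    by (intro ddir_cong[OF S x] ddir_linear_compose bounded_linear_coord smooth_on_differentiable[OF p])
  also have "\<dots> = ddir a (ddir b p) x $$ k"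
    by (intro ddir_linear_compose bounded_linear_coord smooth_on_differentiable[OF smooth_on_ddir[OF p]] x)
  finally show ?thesis .
qed

locale block_coordinates =
  fixes v w :: nat and n_type :: "'n::{finite,linorder} itself" and w_type :: "'w::{finite,linorder} itself"
  assumes dim: "CARD('n) = w * v" and w: "w = CARD('w)"
begin

lemma v_pos: "v > 0"
  using dim zero_less_card_finite[where 'a='n] by (cases v) simp_all

definition unit_vec :: "nat \<Rightarrow> nat \<Rightarrow> 'n rvec"
  where "unit_vec k l = axis (idx (sidx v k + l)) 1"

definition comp :: "nat \<Rightarrow> nat \<Rightarrow> 'n rvec \<Rightarrow> real"
  where "comp k l x = x $$ (sidx v k + l)"

abbreviation pd :: "nat \<Rightarrow> nat \<Rightarrow> ('n rvec \<Rightarrow> 'b::real_normed_vector) \<Rightarrow> 'n rvec \<Rightarrow> 'b"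
  where "pd k l \<equiv> ddir (unit_vec k l)"

definition out :: "'n rvec \<Rightarrow> 'w rvec"
  where "out = first_block v"

abbreviation outs :: "nat set"
  where "outs \<equiv> {1..w}"

lemma partial_eq_pd: "partial (sidx v k + l) F = pd k l F"
  by (simp add: fun_eq_iff partial_def ddir_def unit_vec_def)

lemma index_cases:
  assumes "i \<in> {1..CARD('n)}"
  obtains k l where "k \<in> outs" "l < v" "i = sidx v k + l"
  using assms sidx_cases unfolding dim by blast

lemma index_in_range: "k \<in> outs \<Longrightarrow> l < v \<Longrightarrow> sidx v k + l \<in> {1..CARD('n)}"
  unfolding dim by (rule sidx_in_range)

lemma index_eq_iff:
  "k \<in> outs \<Longrightarrow> l < v \<Longrightarrow> k' \<in> outs \<Longrightarrow> l' < v \<Longrightarrow>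
    sidx v k + l = sidx v k' + l' \<longleftrightarrow> k = k' \<and> l = l'"
  using blk_sidx[of l v k] blk_sidx[of l' v k'] hat_sidx[of l v k] hat_sidx[of l' v k'] by auto

lemma bounded_linear_comp: "bounded_linear (comp k l)"
  unfolding comp_def by (rule bounded_linear_coord)

lemmas comp_linear =
  linear_add[OF bounded_linear.linear[OF bounded_linear_comp]]
  linear_diff[OF bounded_linear.linear[OF bounded_linear_comp]]
  linear_scale[OF bounded_linear.linear[OF bounded_linear_comp]]
  linear_0[OF bounded_linear.linear[OF bounded_linear_comp]]
  linear_sum[OF bounded_linear.linear[OF bounded_linear_comp]]

lemma comp_unit_vec:
  "k \<in> outs \<Longrightarrow> l < v \<Longrightarrow> k' \<in> outs \<Longrightarrow> l' < v \<Longrightarrow>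
    comp k l (unit_vec k' l') = (if k = k' \<and> l = l' then 1 else 0)"
  unfolding comp_def unit_vec_def
  using coord_axis[OF index_in_range index_in_range, of k' l' k l] index_eq_iff[of k' l' k l] by auto

lemma comp_mkvec:
  "k \<in> outs \<Longrightarrow> l < v \<Longrightarrow> comp k l (mkvec g) = g (sidx v k + l)"
  unfolding comp_def by (rule coord_mkvec[OF index_in_range])

lemma comp_eqI: "(\<And>k l. k \<in> outs \<Longrightarrow> l < v \<Longrightarrow> comp k l x = comp k l y) \<Longrightarrow> x = y"
  by (rule coord_eqI, erule index_cases) (simp add: comp_def)

lemma comp_expansion: "x = (\<Sum>k\<in>outs. \<Sum>l<v. comp k l x *\<^sub>R unit_vec k l)"
proof (rule comp_eqI)
  fix k l assume kl: "k \<in> outs" "l < v"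
  have "comp k l (\<Sum>k\<in>outs. \<Sum>l<v. comp k l x *\<^sub>R unit_vec k l) =
      (\<Sum>k'\<in>outs. \<Sum>l'<v. if k' = k \<and> l' = l then comp k l x else 0)"
    using kl by (auto simp: comp_linear comp_unit_vec simp del: atLeastAtMost_iff intro!: sum.cong)
  also have "\<dots> = (\<Sum>k'\<in>outs. if k' = k then comp k l x else 0)"
  proof (rule sum.cong[OF refl])
    show "(\<Sum>l'<v. if k' = k \<and> l' = l then comp k l x else 0) = (if k' = k then comp k l x else 0)" for k'
      using kl by (cases "k' = k") auto
  qed
  also have "\<dots> = comp k l x" using kl by simp
  finally show "comp k l x = comp k l (\<Sum>k\<in>outs. \<Sum>l<v. comp k l x *\<^sub>R unit_vec k l)" by simp
qed

lemma ddir_expansion: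
  assumes "F differentiable (at x)"
  shows "ddir u F x = (\<Sum>k\<in>outs. \<Sum>l<v. comp k l u *\<^sub>R pd k l F x)"
proof -
  note L = linear_ddir[OF assms]
  have "ddir u F x = ddir (\<Sum>k\<in>outs. \<Sum>l<v. comp k l u *\<^sub>R unit_vec k l) F x"
    using comp_expansion[of u] by simp
  also have "\<dots> = (\<Sum>k\<in>outs. \<Sum>l<v. comp k l u *\<^sub>R pd k l F x)"
    by (simp add: linear_sum[OF L] linear_scale[OF L])
  finally show ?thesis .
qed

lemma out_coord: "k \<in> outs \<Longrightarrow> out x $$ k = comp k 0 x"
  by (simp add: out_def first_block_def coord_mkvec comp_def w)

lemma out_eq_iff: "out x = out y \<longleftrightarrow> (\<forall>k\<in>outs. comp k 0 x = comp k 0 y)"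
proof
  show "\<forall>k\<in>outs. comp k 0 x = comp k 0 y" if "out x = out y"
    using that out_coord by metis
  show "out x = out y" if "\<forall>k\<in>outs. comp k 0 x = comp k 0 y"
    using that by (intro coord_eqI) (simp add: out_coord w)
qed

lemma bounded_linear_out: "bounded_linear out"
proof -
  have "linear out"
    unfolding out_def first_block_def
    by (rule linearI) (auto simp: vec_eq_iff mkvec_def coord_def)
  then show ?thesis by (simp add: linear_conv_bounded_linear)
qed

section \<open>The operator \<open>D\<close> and smooth functions of the outputs\<close>

definition D :: "('n rvec \<Rightarrow> 'b::euclidean_space) \<Rightarrow> 'n rvec \<Rightarrow> 'b"
  where "D F x = (\<Sum>k\<in>outs. \<Sum>l=1..v-1. comp k l x *\<^sub>R pd k (l - 1) F x)"

lemma total_D_eq: "total_D v = (D :: ('n rvec \<Rightarrow> 'w rvec) \<Rightarrow> _)"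
proof (intro ext)
  fix F :: "'n rvec \<Rightarrow> 'w rvec" and x
  have "partial (sidx v k + l - 1) F x = pd k (l - 1) F x" if "l \<in> {1..v-1}" for k l
    using that partial_eq_pd[of k "l - 1" F] by simp
  then show "total_D v F x = D F x"
    unfolding total_D_def w[symmetric] D_def comp_def by (auto intro!: sum.cong)
qed

lemma smooth_on_D: "open S \<Longrightarrow> smooth_on S F \<Longrightarrow> smooth_on S (D F)"
  unfolding D_def[abs_def]
  by (intro smooth_on_sum)
    (auto intro: smooth_on_scaleR[OF _ smooth_on_bounded_linear[OF bounded_linear_comp] smooth_on_ddir])

lemma smooth_on_D_pow: "open S \<Longrightarrow> smooth_on S F \<Longrightarrow> smooth_on S ((D ^^ r) F)"
  by (induction r) (simp_all add: smooth_on_D)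

lemma D_cong:
  assumes "open S" "x \<in> S" "\<And>y. y \<in> S \<Longrightarrow> F y = G y"
  shows "D F x = D G x"
  unfolding D_def using ddir_cong[OF assms] by simp

lemma ddir_cmult:
  assumes "F differentiable (at x)"
  shows "ddir u (\<lambda>y. (a::real) *\<^sub>R F y) x = a *\<^sub>R ddir u F x"
  by (rule ddir_linear_compose[OF bounded_linear_scaleR_right assms])

lemma D_cmult:
  assumes "F differentiable (at x)"
  shows "D (\<lambda>y. a *\<^sub>R F y) x = a *\<^sub>R D F x"
  using assms by (simp add: D_def ddir_cmult scaleR_sum_right mult.commute)

lemma D_eq_0: "(\<And>k l. k \<in> outs \<Longrightarrow> l \<in> {1..v-1} \<Longrightarrow> comp k l x = 0) \<Longrightarrow> D F x = 0"
  by (simp add: D_def)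

text \<open>The commutator of the two operators: differentiating the coefficient
  \<open>comp k l\<close> of \<open>D\<close> leaves \<open>pd k (l - 1) F\<close>, and everything
  else is symmetry of second derivatives. For \<open>l = 0\<close> no coefficient of
  \<open>D\<close> depends on the variable, as its sum starts at 1.\<close>

lemma pd_D:
  assumes S: "open S" "x \<in> S" and F: "smooth_on S F" and k: "k \<in> outs" and l: "l < v"
  shows "pd k l (D F) x = D (pd k l F) x + (if l = 0 then 0 else pd k (l - 1) F x)"
proof -
  have d: "comp k' l' differentiable (at x)" "pd k' l' F differentiable (at x)" for k' l'
    by (auto intro: bounded_linear_imp_differentiable bounded_linear_comp
        smooth_on_differentiable[OF smooth_on_ddir[OF F]] S)
  then have "pd k l (D F) x = (\<Sum>k'\<in>outs. \<Sum>l'=1..v-1.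
      comp k' l' x *\<^sub>R pd k l (pd k' (l' - 1) F) x + comp k' l' (unit_vec k l) *\<^sub>R pd k' (l' - 1) F x)"
    unfolding D_def[abs_def]
    by (simp add: ddir_sum ddir_scaleR ddir_bounded_linear bounded_linear_comp)
  also have "\<dots> = (\<Sum>k'\<in>outs. \<Sum>l'=1..v-1.
      comp k' l' x *\<^sub>R pd k' (l' - 1) (pd k l F) x + (if k' = k \<and> l' = l then pd k (l - 1) F x else 0))"
    using k l
    by (intro sum.cong refl) (auto simp: comp_unit_vec ddir_commute[OF S F, of "unit_vec k l"])
  also have "\<dots> = D (pd k l F) x +
      (\<Sum>k'\<in>outs. if k' = k then \<Sum>l'=1..v-1. (if l' = l then pd k (l - 1) F x else 0) else 0)"
    unfolding D_def sum.distrib by (intro arg_cong2[of _ _ _ _ "(+)"] refl sum.cong) auto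
  also have "\<dots> = D (pd k l F) x + (if l = 0 then 0 else pd k (l - 1) F x)"
    using k l by auto
  finally show ?thesis .
qed

text \<open>Smooth functions of the outputs alone, up to connectedness of the slices of \<open>S\<close>.\<close>

definition basic_on :: "'n rvec set \<Rightarrow> ('n rvec \<Rightarrow> 'b::euclidean_space) \<Rightarrow> bool"
  where "basic_on S F \<longleftrightarrow> smooth_on S F \<and> (\<forall>x\<in>S. \<forall>k\<in>outs. \<forall>l\<in>{1..<v}. pd k l F x = 0)"

text \<open>Makes \<open>pd_D_pow\<close> applicable a second time, to \<open>pd k 0 F\<close>,
  which is how second derivatives of \<open>(D ^^ r) F\<close> are computed.\<close>

lemma basic_on_pd:
  assumes S: "open S" and F: "basic_on S F" and k: "k \<in> outs"
  shows "basic_on S (pd k 0 F)"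
  unfolding basic_on_def
proof (intro conjI ballI)
  show "smooth_on S (pd k 0 F)" using F by (simp add: basic_on_def smooth_on_ddir)
  fix x a l assume x: "x \<in> S" and al: "a \<in> outs" "l \<in> {1..<v}"
  have "pd a l (pd k 0 F) x = pd k 0 (pd a l F) x"
    using F x S by (intro ddir_commute) (auto simp: basic_on_def)
  also have "\<dots> = pd k 0 (\<lambda>x. 0) x"
    using F al by (intro ddir_cong[OF S x]) (auto simp: basic_on_def)
  finally show "pd a l (pd k 0 F) x = 0" by simp
qed

lemma basic_on_out:
  assumes N: "open N" "smooth_on N B" and S: "open S" "out ` S \<subseteq> N"
  shows "basic_on S (\<lambda>x. B (out x))"
  unfolding basic_on_def
proof (intro conjI ballI)
  show "smooth_on S (\<lambda>x. B (out x))"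
    by (rule smooth_on_compose[OF S(1) N(2) smooth_on_bounded_linear[OF bounded_linear_out] S(2)])
  fix x k l assume x: "x \<in> S" and kl: "k \<in> outs" "l \<in> {1..<v}"
  have "out (unit_vec k l) = out 0"
    unfolding out_eq_iff using kl by (auto simp: comp_unit_vec comp_linear)
  then have "ddir (unit_vec k l) out x = 0"
    using linear_0[OF bounded_linear.linear[OF bounded_linear_out]]
    by (simp add: ddir_bounded_linear bounded_linear_out)
  moreover have "B differentiable (at (out x))"
    using x S N(2) smooth_on_differentiable by blast
  ultimately show "pd k l (\<lambda>x. B (out x)) x = 0"
    using ddir_compose(2)[OF bounded_linear_imp_differentiable[OF bounded_linear_out], where F = B]
    by simp
qed

text \<open>Induction on \<open>r\<close> with the commutator \<open>pd_D\<close>: its two terms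
  carry the coefficients \<open>r choose l\<close> and \<open>r choose (l - 1)\<close>, which add up
  by Pascal's rule. For \<open>l > r\<close> the truncated exponent \<open>r - l\<close> does no
  harm because the coefficient is 0.\<close>

lemma pd_D_pow:
  assumes S: "open S" and F: "basic_on S F" and k: "k \<in> outs" and l: "l < v" and x: "x \<in> S"
  shows "pd k l ((D ^^ r) F) x = real (r choose l) *\<^sub>R (D ^^ (r - l)) (pd k 0 F) x"
  using l x
proof (induction r arbitrary: l x)
  case 0
  then show ?case using F k by (cases "l = 0") (auto simp: basic_on_def)
next
  case (Suc r)
  have sm: "smooth_on S ((D ^^ m) (pd k 0 F))" "smooth_on S ((D ^^ m) F)" for m
    using F S by (auto simp: basic_on_def intro!: smooth_on_D_pow smooth_on_ddir)
  have *: "D (pd k l ((D ^^ r) F)) x = real (r choose l) *\<^sub>R (D ^^ Suc (r - l)) (pd k 0 F) x"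
    using Suc.prems
    by (simp add: D_cong[OF S _ Suc.IH[OF Suc.prems(1)]] D_cmult smooth_on_differentiable[OF sm(1)])
  have "pd k l ((D ^^ Suc r) F) x =
      D (pd k l ((D ^^ r) F)) x + (if l = 0 then 0 else pd k (l - 1) ((D ^^ r) F) x)"
    using Suc.prems by (simp add: pd_D[OF S _ sm(2) k])
  also have "\<dots> = real (Suc r choose l) *\<^sub>R (D ^^ (Suc r - l)) (pd k 0 F) x"
  proof (cases l)
    case 0
    then show ?thesis unfolding * by simp
  next
    case (Suc m)
    then have m: "pd k (l - 1) ((D ^^ r) F) x = real (r choose m) *\<^sub>R (D ^^ (r - m)) (pd k 0 F) x"
      using Suc.IH[of m x] Suc.prems by simp
    show ?thesis
    proof (cases "l \<le> r")
      case True
      then have "Suc (r - l) = r - m" "Suc r - l = r - m" using Suc by auto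
      then show ?thesis
        unfolding * m using Suc by (simp add: scaleR_add_left)
    next
      case False
      then show ?thesis unfolding * m using Suc by (simp add: binomial_eq_0)
    qed
  qed
  finally show ?case .
qed

section \<open>The Pascal-Hessian condition in block indices\<close>

definition PH_on :: "'n rvec set \<Rightarrow> ('n rvec \<Rightarrow> 'b::euclidean_space) \<Rightarrow> bool"
  where "PH_on S F \<longleftrightarrow> (\<forall>x\<in>S. \<forall>a\<in>outs. \<forall>b\<in>outs. \<forall>i<v. \<forall>j<v.
    pd a i (pd b j F) x =
      (if i + j < v then real ((i + j) choose i) *\<^sub>R pd a 0 (pd b (i + j) F) x else 0))"

text \<open>Applying \<open>pd_D_pow\<close> twice shows that all second derivatives with the same
  \<open>a\<close>, \<open>b\<close> and index sum \<open>i + j\<close> are multiples of one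
  function, \<open>(D ^^ (r - i - j)) (pd a 0 (pd b 0 F))\<close>, so that only coefficients remain
  to be compared.\<close>

lemma PH_on_D_pow:
  assumes S: "open S" and F: "basic_on S F" and r: "r < v"
  shows "PH_on S ((D ^^ r) F)"
  unfolding PH_on_def
proof (intro ballI allI impI)
  fix x a b i j assume x: "x \<in> S" and ab: "a \<in> outs" "b \<in> outs" and ij: "i < v" "j < v"
  note Fb = basic_on_pd[OF S F ab(2)]
  have sm: "smooth_on S ((D ^^ m) (pd b 0 F))" for m
    using Fb S by (auto simp: basic_on_def intro!: smooth_on_D_pow)
  have second: "pd a i' (pd b j' ((D ^^ r) F)) x =
      real ((r choose j') * ((r - j') choose i')) *\<^sub>R (D ^^ (r - j' - i')) (pd a 0 (pd b 0 F)) x"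
    if "i' < v" "j' < v" for i' j'
  proof -
    have "pd a i' (pd b j' ((D ^^ r) F)) x =
        pd a i' (\<lambda>x. real (r choose j') *\<^sub>R (D ^^ (r - j')) (pd b 0 F) x) x"
      by (intro ddir_cong[OF S x] pd_D_pow[OF S F ab(2) that(2)])
    also have "\<dots> = real (r choose j') *\<^sub>R pd a i' ((D ^^ (r - j')) (pd b 0 F)) x"
      by (intro ddir_cmult smooth_on_differentiable[OF sm x])
    finally show ?thesis
      by (simp add: pd_D_pow[OF S Fb ab(1) that(1) x])
  qed
  show "pd a i (pd b j ((D ^^ r) F)) x =
      (if i + j < v then real ((i + j) choose i) *\<^sub>R pd a 0 (pd b (i + j) ((D ^^ r) F)) x else 0)"
  proof (cases "i + j < v")
    case False
    \<comment> \<open>Since i + j \<ge> v > r, either j > r or i > r - j, so one of the factors is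
      0.\<close>
    then have "(r choose j) * ((r - j) choose i) = 0" using r by auto
    then show ?thesis using False by (simp only: second[OF ij]) simp
  next
    case True
    have "(r choose j) * ((r - j) choose i) = (r choose (i + j)) * ((i + j) choose i)"
    proof (cases "i + j \<le> r")
      case le: True
      then have "(r choose (i + j)) * ((i + j) choose j) = (r choose j) * ((r - j) choose i)"
        by (subst choose_mult) auto
      moreover have "(i + j) choose j = (i + j) choose i"
        using binomial_symmetric[of j "i + j"] by simp
      ultimately show ?thesis by simp
    next
      case False
      then show ?thesis by (cases "j \<le> r") (auto simp: binomial_eq_0)
    qed
    moreover have "r - j - i = r - (i + j) - 0" by simp
    ultimately show ?thesis
      using True by (simp only: second[OF ij] second[OF v_pos True]) (simp add: mult.commute)
  qed
qed

lemma PH_on_sum: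
  assumes S: "open S" and F: "\<And>r. r \<in> I \<Longrightarrow> smooth_on S (F r)" "\<And>r. r \<in> I \<Longrightarrow> PH_on S (F r)"
  shows "PH_on S (\<lambda>x. \<Sum>r\<in>I. F r x)"
proof -
  have "pd a i (pd b j (\<lambda>x. \<Sum>r\<in>I. F r x)) x = (\<Sum>r\<in>I. pd a i (pd b j (F r)) x)" if "x \<in> S" for a b i j x
  proof -
    have "pd a i (pd b j (\<lambda>x. \<Sum>r\<in>I. F r x)) x = pd a i (\<lambda>x. \<Sum>r\<in>I. pd b j (F r) x) x"
      by (intro ddir_cong[OF S that] ddir_sum smooth_on_differentiable[OF F(1)])
    also have "\<dots> = (\<Sum>r\<in>I. pd a i (pd b j (F r)) x)"
      using that by (intro ddir_sum smooth_on_differentiable[OF smooth_on_ddir[OF F(1)]])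
    finally show ?thesis .
  qed
  note eq = this
  show ?thesis
    unfolding PH_on_def
  proof (intro ballI allI impI)
    fix x a b i j assume *: "x \<in> S" "a \<in> outs" "b \<in> outs" "i < v" "j < v"
    have "(\<Sum>r\<in>I. pd a i (pd b j (F r)) x) = (\<Sum>r\<in>I.
        if i + j < v then real ((i + j) choose i) *\<^sub>R pd a 0 (pd b (i + j) (F r)) x else 0)"
      using F(2) * unfolding PH_on_def by (intro sum.cong refl) blast
    then show "pd a i (pd b j (\<lambda>x. \<Sum>r\<in>I. F r x)) x = (if i + j < v
        then real ((i + j) choose i) *\<^sub>R pd a 0 (pd b (i + j) (\<lambda>x. \<Sum>r\<in>I. F r x)) x else 0)"
      unfolding eq[OF *(1)] by (simp add: scaleR_sum_right)
  qed
qed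

lemma PH_on_diff:
  assumes S: "open S" and F: "smooth_on S F" "PH_on S F" and G: "smooth_on S G" "PH_on S G"
  shows "PH_on S (\<lambda>x. F x - G x)"
proof -
  have "pd a i (pd b j (\<lambda>x. F x - G x)) x = pd a i (pd b j F) x - pd a i (pd b j G) x"
    if "x \<in> S" for a b i j x
  proof -
    have "pd a i (pd b j (\<lambda>x. F x - G x)) x = pd a i (\<lambda>x. pd b j F x - pd b j G x) x"
      by (intro ddir_cong[OF S that] ddir_diff smooth_on_differentiable[OF F(1)]
          smooth_on_differentiable[OF G(1)])
    also have "\<dots> = pd a i (pd b j F) x - pd a i (pd b j G) x"
      using that by (intro ddir_diff smooth_on_differentiable[OF smooth_on_ddir[OF F(1)]]
          smooth_on_differentiable[OF smooth_on_ddir[OF G(1)]])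
    finally show ?thesis .
  qed
  note eq = this
  show ?thesis
    unfolding PH_on_def
  proof (intro ballI allI impI)
    fix x a b i j assume *: "x \<in> S" "a \<in> outs" "b \<in> outs" "i < v" "j < v"
    show "pd a i (pd b j (\<lambda>x. F x - G x)) x = (if i + j < v
        then real ((i + j) choose i) *\<^sub>R pd a 0 (pd b (i + j) (\<lambda>x. F x - G x)) x else 0)"
      unfolding eq[OF *(1)]
        F(2)[unfolded PH_on_def, rule_format, OF *] G(2)[unfolded PH_on_def, rule_format, OF *]
      by (simp add: scaleR_diff_right)
  qed
qed

lemma PH_on_cong:
  assumes S: "open S" and eq: "\<And>x. x \<in> S \<Longrightarrow> F x = G x"
  shows "PH_on S F \<longleftrightarrow> PH_on S G"
proof -
  have "pd a i (pd b j F) x = pd a i (pd b j G) x" if "x \<in> S" for a b i j x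
    by (intro ddir_cong[OF S that] ddir_cong[OF S _ eq])
  then show ?thesis unfolding PH_on_def by simp
qed

text \<open>Passing to \<open>PH_on\<close> trades the flat indices with \<open>blk\<close> and
  \<open>hat\<close> for pairs of a block and a 0-based position, and the quantifier over components
  for a single vector equation.\<close>

lemma pascal_hessian_iff:
  fixes p :: "'n rvec \<Rightarrow> 'w rvec"
  assumes S: "open S" and p: "smooth_on S p"
  shows "pascal_hessian v S p \<longleftrightarrow> PH_on S p"
proof -
  note comp2 = ddir_ddir_coord[OF S p]
  have "pascal_hessian v S p \<longleftrightarrow> (\<forall>x\<in>S. \<forall>k\<in>outs. \<forall>a\<in>outs. \<forall>b\<in>outs. \<forall>i<v. \<forall>j<v.
      pd a i (pd b j (\<lambda>x. p x $$ k)) x = (if i + j < v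
        then real ((i + j) choose i) * pd a 0 (pd b (i + j) (\<lambda>x. p x $$ k)) x else 0))" (is "_ = ?R")
  proof
    assume H: "pascal_hessian v S p"
    show ?R
    proof (intro ballI allI impI)
      fix x k a b i j assume *: "x \<in> S" "k \<in> outs" "a \<in> outs" "b \<in> outs" "i < v" "j < v"
      have "blk v (sidx v a + i) = a" "blk v (sidx v b + j) = b"
        "hat v (sidx v a + i) = i" "hat v (sidx v b + j) = j"
        using * by (auto simp: blk_sidx hat_sidx)
      moreover have "sidx v a + i \<in> {1..CARD('n)}" "sidx v b + j \<in> {1..CARD('n)}"
        using index_in_range * by blast+
      moreover have "i + j \<le> v - 1 \<longleftrightarrow> i + j < v" using v_pos by auto
      moreover have "partial (sidx v a) F = pd a 0 F" for F :: "'n rvec \<Rightarrow> real"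
        using partial_eq_pd[of a 0 F] by simp
      ultimately show "pd a i (pd b j (\<lambda>x. p x $$ k)) x = (if i + j < v
          then real ((i + j) choose i) * pd a 0 (pd b (i + j) (\<lambda>x. p x $$ k)) x else 0)"
        using H[unfolded pascal_hessian_def w[symmetric], rule_format, OF *(1,2), of "sidx v a + i" "sidx v b + j"]
        by (simp add: partial_eq_pd add.assoc del: atLeastAtMost_iff)
    qed
  next
    assume H: ?R
    show "pascal_hessian v S p"
      unfolding pascal_hessian_def w[symmetric]
    proof (intro ballI)
      fix x k m n assume *: "x \<in> S" "k \<in> outs" and mn: "m \<in> {1..CARD('n)}" "n \<in> {1..CARD('n)}"
      obtain a i b j where ab: "a \<in> outs" "i < v" "m = sidx v a + i" "b \<in> outs" "j < v" "n = sidx v b + j"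
        using mn by (metis index_cases)
      then have "blk v m = a" "blk v n = b" "hat v m = i" "hat v n = j"
        by (auto simp: blk_sidx hat_sidx)
      moreover have "i + j \<le> v - 1 \<longleftrightarrow> i + j < v" using v_pos by auto
      moreover have "partial (sidx v a) F = pd a 0 F" for F :: "'n rvec \<Rightarrow> real"
        using partial_eq_pd[of a 0 F] by simp
      ultimately show "partial m (partial n (\<lambda>\<xi>. p \<xi> $$ k)) x =
         (if hat v m + hat v n \<le> v - 1
          then real ((hat v m + hat v n) choose hat v m) *
               partial (sidx v (blk v m))
                 (partial (sidx v (blk v n) + hat v m + hat v n) (\<lambda>\<xi>. p \<xi> $$ k)) x
          else 0)"
        using H[rule_format, OF *(1,2) ab(1,4,2,5)] ab
        by (simp add: partial_eq_pd add.assoc del: atLeastAtMost_iff)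
    qed
  qed
  also have "\<dots> \<longleftrightarrow> (\<forall>x\<in>S. \<forall>k\<in>outs. \<forall>a\<in>outs. \<forall>b\<in>outs. \<forall>i<v. \<forall>j<v.
      pd a i (pd b j p) x $$ k = (if i + j < v
        then real ((i + j) choose i) * pd a 0 (pd b (i + j) p) x $$ k else 0))"
    by (rule ball_cong[OF refl]) (simp only: comp2)
  also have "\<dots> \<longleftrightarrow> PH_on S p"
  proof -
    have vec_eq: "y = (if c then r *\<^sub>R z else 0) \<longleftrightarrow> (\<forall>k\<in>outs. y $$ k = (if c then r * z $$ k else 0))"
      for y z :: "'w rvec" and c r
      by (auto intro!: coord_eqI simp: coord_def w)
    show ?thesis
      unfolding PH_on_def by (simp only: vec_eq) blast
  qed
  finally show ?thesis .
qed

text \<open>A slice need not be convex, so constancy is first local: inside a ball in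
  \<open>S\<close>, two points of the slice are joined by a segment whose direction has zero output
  components, and along the remaining components the derivative vanishes. Connectedness makes this
  global.\<close>

lemma eq_on_slice:
  assumes S: "open S" and F: "smooth_on S F"
    and z: "\<And>x k l. x \<in> S \<Longrightarrow> k \<in> outs \<Longrightarrow> l \<in> {1..<v} \<Longrightarrow> pd k l F x = 0"
    and conn: "connected {x \<in> S. out x = c}"
    and xy: "x \<in> S" "y \<in> S" "out x = c" "out y = c"
  shows "F x = F y"
proof (rule connected_local_const[OF conn])
  show "\<forall>a\<in>{x \<in> S. out x = c}. eventually (\<lambda>b. F a = F b) (at a within {x \<in> S. out x = c})"
  proof
    fix a assume a: "a \<in> {x \<in> S. out x = c}"
    then obtain e where e: "e > 0" "ball a e \<subseteq> S" using S openE by blast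
    have "F a = F b" if b: "b \<in> ball a e" "out b = c" for b
    proof (rule eq_if_ddir_zero_on_segment[where F = F])
      fix z assume "z \<in> closed_segment a b"
      then have zS: "z \<in> S"
        using e b(1) closed_segment_subset[of a "ball a e" b] by auto
      then show dz: "F differentiable (at z)" by (rule smooth_on_differentiable[OF F])
      have 0: "comp k 0 (b - a) = 0" if "k \<in> outs" for k
        using a b that out_eq_iff[of b a] by (simp add: comp_linear)
      have summand: "comp k l (b - a) *\<^sub>R pd k l F z = 0" if "k \<in> outs" "l < v" for k l
        using assms(3)[OF zS that(1)] 0 that by (cases "l = 0") auto
      then show "ddir (b - a) F z = 0"
        unfolding ddir_expansion[OF dz, of "b - a"] by (intro sum.neutral ballI) (rule summand, auto)
    qed
    then show "eventually (\<lambda>b. F a = F b) (at a within {x \<in> S. out x = c})"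
      unfolding eventually_at using e by (auto intro!: exI[of _ e] simp: dist_commute)
  qed
qed (use xy in auto)

end

section \<open>Transformation into the observer canonical form\<close>

lemma smooth_on_coordI:
  fixes F :: "'a::real_normed_vector \<Rightarrow> 'm::{finite,linorder} rvec"
  assumes S: "open S" and F: "\<And>i. i \<in> {1..CARD('m)} \<Longrightarrow> smooth_on S (\<lambda>x. F x $$ i)"
  shows "smooth_on S F"
proof -
  have "smooth_on S (\<lambda>x. F x $ k)" for k
  proof -
    have "pos k \<in> {1..CARD('m)}" using range_pos[where 'n='m] by blast
    from F[OF this] show ?thesis by (simp add: coord_def idx_pos)
  qed
  then have "smooth_on S (\<lambda>x. \<Sum>k\<in>UNIV. F x $ k *\<^sub>R (axis k 1 :: 'm rvec))"
    by (intro smooth_on_sum[OF S] smooth_on_scaleR[OF S] smooth_on_const)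
  moreover have "(\<lambda>x. \<Sum>k\<in>UNIV. F x $ k *\<^sub>R (axis k 1 :: 'm rvec)) = F"
    by (simp add: fun_eq_iff vec_eq_iff axis_def if_distrib[of "\<lambda>c. _ * c"] cong: if_cong)
  ultimately show ?thesis by (simp only:)
qed

text \<open>The inverse may live on an open set \<open>Y\<close> larger than the image. Openness of
  the image then needs no inverse function theorem: it is the preimage of \<open>W\<close> under the
  continuous map \<open>S\<close>.\<close>

lemma diffeo_onI:
  fixes T :: "'a::euclidean_space \<Rightarrow> 'a"
  assumes W: "open W" "smooth_on W T" and Y: "open Y" "smooth_on Y S"
    and TY: "T ` W \<subseteq> Y" and ST: "\<And>x. x \<in> W \<Longrightarrow> S (T x) = x" and TS: "\<And>y. y \<in> Y \<Longrightarrow> T (S y) = y"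
  shows "diffeo_on W T"
proof -
  have im: "T ` W = S -` W \<inter> Y"
    using TY ST TS by (force simp: image_iff)
  have inj: "inj_on T W" using ST by (rule inj_on_inverseI)
  have op: "open (T ` W)"
    unfolding im using smooth_on_continuous_on[OF Y(2)] Y(1) W(1)
    by (simp add: continuous_on_open_vimage)
  have "smooth_on (T ` W) (inv_into W T) \<longleftrightarrow> smooth_on (T ` W) S"
  proof (rule smooth_on_cong[OF op])
    show "inv_into W T y = S y" if "y \<in> T ` W" for y
      using that inj ST by (auto simp: inv_into_f_f)
  qed
  then show ?thesis
    unfolding diffeo_on_def using W op inj smooth_on_subset[OF Y(2) TY] by simp
qed

context block_coordinates
begin

lemma smooth_on_compI:
  assumes "open S" "\<And>k l. k \<in> outs \<Longrightarrow> l < v \<Longrightarrow> smooth_on S (\<lambda>x. comp k l (F x))"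
  shows "smooth_on S F"
proof (rule smooth_on_coordI[OF assms(1)])
  fix i assume "i \<in> {1..CARD('n)}"
  then show "smooth_on S (\<lambda>x. F x $$ i)"
    using assms(2) by (elim index_cases) (simp add: comp_def)
qed

section \<open>The matrices of the observer form and the order of the blocks\<close>

lemma bij_betw_index:
  "bij_betw (\<lambda>(k, l). idx (sidx v k + l) :: 'n) (outs \<times> {..<v}) UNIV"
  unfolding bij_betw_def
proof
  show "inj_on (\<lambda>(k, l). idx (sidx v k + l) :: 'n) (outs \<times> {..<v})"
  proof -
    have "k = k' \<and> l = l'" if *: "k \<in> outs" "l < v" "k' \<in> outs" "l' < v"
      and eq: "(idx (sidx v k + l) :: 'n) = idx (sidx v k' + l')" for k l k' l'
      using idx_eq_iff[OF index_in_range[OF *(1,2)] index_in_range[OF *(3,4)]] eq index_eq_iff[OF *] by simp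
    then show ?thesis unfolding inj_on_def by auto
  qed
  show "(\<lambda>(k, l). idx (sidx v k + l) :: 'n) ` (outs \<times> {..<v}) = UNIV"
  proof (rule UNIV_eq_I[symmetric])
    fix i :: 'n
    have "pos i \<in> {1..CARD('n)}" using range_pos[where 'n='n] by blast
    then obtain k l where "k \<in> outs" "l < v" "pos i = sidx v k + l" by (rule index_cases)
    then show "i \<in> (\<lambda>(k, l). idx (sidx v k + l) :: 'n) ` (outs \<times> {..<v})"
      by (intro image_eqI[of _ _ "(k, l)"]) (use idx_pos[of i] in auto)
  qed
qed

lemma sum_UNIV_index: "(\<Sum>i\<in>UNIV. g (i::'n)) = (\<Sum>k\<in>outs. \<Sum>l<v. g (idx (sidx v k + l)))"
  unfolding sum.cartesian_product
  by (subst sum.reindex_bij_betw[OF bij_betw_index, symmetric]) (simp add: case_prod_unfold)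

lemma mkvec_nth_index: "k \<in> outs \<Longrightarrow> l < v \<Longrightarrow> mkvec g $ (idx (sidx v k + l) :: 'n) = g (sidx v k + l)"
  using index_in_range[of k l] by (simp add: mkvec_def pos_idx)

lemma comp_ocf_A:
  assumes k: "k \<in> outs" and l: "l < v"
  shows "comp k l (ocf_A v *v z) = (if l = 0 then 0 else comp k (l - 1) z)"
proof -
  have "comp k l (ocf_A v *v z) =
      (\<Sum>k'\<in>outs. \<Sum>l'<v. (if k = k' then A0 l l' else 0) * comp k' l' z)"
    using k l unfolding comp_def coord_def matrix_vector_mult_def ocf_A_def vec_lambda_beta sum_UNIV_index
    by (intro sum.cong refl) (simp add: mkvec_nth_index blk_sidx hat_sidx)
  also have "\<dots> = (\<Sum>k'\<in>outs. if k' = k then \<Sum>l'<v. A0 l l' * comp k l' z else 0)"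
    by (intro sum.cong refl) auto
  also have "\<dots> = (\<Sum>l'<v. A0 l l' * comp k l' z)" using k by simp
  \<comment> \<open>The inner case distinction is needed since \<open>l - 1\<close> is 0 for
    \<open>l = 0\<close>, where the first row of \<open>A0\<close> has no entry 1.\<close>
  also have "\<dots> = (\<Sum>l'<v. if l' = l - 1 then if l = 0 then 0 else comp k l' z else 0)"
    using l by (intro sum.cong refl) (auto simp: A0_def)
  also have "\<dots> = (if l = 0 then 0 else comp k (l - 1) z)" using l by simp
  finally show ?thesis .
qed

lemma coord_ocf_C:
  assumes k: "k \<in> outs"
  shows "((ocf_C v :: ('n rvec, 'w) vec) *v z) $$ k = comp k (v - 1) z"
proof -
  have row: "(ocf_C v :: ('n rvec, 'w) vec) $ idx k = mkvec (\<lambda>j. if k = blk v j then C0 v (hat v j) else 0)"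
    using coord_mkvec[where 'n='w, of k] k unfolding ocf_C_def coord_def w by blast
  have "((ocf_C v :: ('n rvec, 'w) vec) *v z) $$ k =
      (\<Sum>k'\<in>outs. \<Sum>l'<v. (if k = k' then C0 v l' else 0) * comp k' l' z)"
    unfolding comp_def coord_def matrix_vector_mult_def vec_lambda_beta sum_UNIV_index row
    by (intro sum.cong refl) (simp add: mkvec_nth_index blk_sidx hat_sidx)
  also have "\<dots> = (\<Sum>k'\<in>outs. if k' = k then \<Sum>l'<v. C0 v l' * comp k l' z else 0)"
    by (intro sum.cong refl) auto
  also have "\<dots> = (\<Sum>l'<v. C0 v l' * comp k l' z)" using k by simp
  also have "\<dots> = (\<Sum>l'<v. if l' = v - 1 then comp k l' z else 0)"
    by (intro sum.cong refl) (auto simp: C0_def)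
  also have "\<dots> = comp k (v - 1) z" using v_pos by simp
  finally show ?thesis .
qed

text \<open>The observer form has the output in the last entry of each block and the highest
  derivative in the first, opposite to the order in \<open>x\<close>; this reversal
  mediates.\<close>

definition flip :: "'n rvec \<Rightarrow> 'n rvec"
  where "flip x = mkvec (\<lambda>i. comp (blk v i) (v - 1 - hat v i) x)"

lemma comp_flip: "k \<in> outs \<Longrightarrow> l < v \<Longrightarrow> comp k l (flip x) = comp k (v - 1 - l) x"
  by (simp add: flip_def comp_mkvec blk_sidx hat_sidx)

lemma flip_flip: "flip (flip x) = x"
  by (rule comp_eqI) (simp add: comp_flip)

lemma bounded_linear_flip: "bounded_linear flip"
proof -
  have "linear flip"
    by (rule linearI; rule comp_eqI) (simp_all add: comp_flip comp_linear)
  then show ?thesis by (simp add: linear_conv_bounded_linear)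
qed

lemma comp_high_order_field:
  "k \<in> outs \<Longrightarrow> l < v \<Longrightarrow>
    comp k l (high_order_field v p x) = (if l < v - 1 then comp k (l + 1) x else (p x :: 'w rvec) $$ k)"
  unfolding high_order_field_def by (simp add: comp_mkvec blk_sidx hat_sidx) (simp add: comp_def)

text \<open>\<open>D\<close> is differentiation along the system as long as \<open>p\<close> does
  not enter. The component of the field containing \<open>p\<close> meets the derivative of index
  \<open>v - 1\<close>, which has the coefficient \<open>r choose (v - 1) = 0\<close>; on all other
  components the field is the shift encoded in \<open>D\<close>.\<close>

lemma ddir_high_order_field:
  assumes S: "open S" "x \<in> S" and F: "basic_on S F" and r: "r < v - 1"
  shows "ddir (high_order_field v (p :: 'n rvec \<Rightarrow> 'w rvec) x) ((D ^^ r) F) x = (D ^^ Suc r) F x"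
proof -
  let ?H = "(D ^^ r) F"
  have "?H differentiable (at x)"
    using S F by (auto simp: basic_on_def intro!: smooth_on_differentiable smooth_on_D_pow)
  then have "ddir (high_order_field v p x) ?H x =
      (\<Sum>k\<in>outs. \<Sum>l<v. comp k l (high_order_field v p x) *\<^sub>R pd k l ?H x)"
    by (rule ddir_expansion)
  also have "\<dots> = (\<Sum>k\<in>outs. \<Sum>l=1..v-1. comp k l x *\<^sub>R pd k (l - 1) ?H x)"
  proof (rule sum.cong[OF refl])
    fix k assume k: "k \<in> outs"
    have "pd k (v - 1) ?H x = 0"
      using pd_D_pow[OF S(1) F k _ S(2), of "v - 1" r] v_pos r by (simp add: binomial_eq_0)
    moreover have "{..<v} = insert (v - 1) {..<v - 1}" using v_pos by auto
    ultimately have "(\<Sum>l<v. comp k l (high_order_field v p x) *\<^sub>R pd k l ?H x) =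
        (\<Sum>l<v-1. comp k l (high_order_field v p x) *\<^sub>R pd k l ?H x)"
      by simp
    also have "\<dots> = (\<Sum>l<v-1. comp k (l + 1) x *\<^sub>R pd k l ?H x)"
      using k by (intro sum.cong refl) (simp add: comp_high_order_field)
    also have "\<dots> = (\<Sum>l=1..v-1. comp k l x *\<^sub>R pd k (l - 1) ?H x)"
      by (rule sum.reindex_bij_witness[of _ "\<lambda>l. l - 1" Suc]) auto
    finally show "(\<Sum>l<v. comp k l (high_order_field v p x) *\<^sub>R pd k l ?H x) =
      (\<Sum>l=1..v-1. comp k l x *\<^sub>R pd k (l - 1) ?H x)" .
  qed
  finally show ?thesis by (simp add: D_def)
qed

text \<open>
  A strictly block-triangular perturbation of the identity is inverted by finitely many steps of
  the fixed-point iteration \<open>x \<mapsto> y + \<Gamma> x\<close>: each step makes one more block correct.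
\<close>

definition triangular_on :: "'n rvec set \<Rightarrow> ('n rvec \<Rightarrow> 'n rvec) \<Rightarrow> bool"
  where "triangular_on Z \<Gamma> \<longleftrightarrow>
    (\<forall>x\<in>Z. \<forall>k\<in>outs. comp k 0 (\<Gamma> x) = 0) \<and>
    (\<forall>x\<in>Z. \<forall>y\<in>Z. \<forall>m<v. (\<forall>k\<in>outs. \<forall>l<m. comp k l x = comp k l y) \<longrightarrow>
      (\<forall>k\<in>outs. comp k m (\<Gamma> x) = comp k m (\<Gamma> y)))"

definition tri_inverse :: "('n rvec \<Rightarrow> 'n rvec) \<Rightarrow> nat \<Rightarrow> 'n rvec \<Rightarrow> 'n rvec"
  where "tri_inverse \<Gamma> j y = ((\<lambda>x. y + \<Gamma> x) ^^ j) y"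

lemma tri_inverse_simps:
  "tri_inverse \<Gamma> 0 y = y" "tri_inverse \<Gamma> (Suc j) y = y + \<Gamma> (tri_inverse \<Gamma> j y)"
  by (simp_all add: tri_inverse_def)

context
  fixes N :: "'w rvec set" and \<Gamma> :: "'n rvec \<Rightarrow> 'n rvec"
  assumes N: "open N" and smooth: "smooth_on (out -` N) \<Gamma>" and tri: "triangular_on (out -` N) \<Gamma>"
begin

lemma open_cylinder: "open (out -` N)"
  using N bounded_linear_out by (simp add: open_vimage linear_continuous_on)

lemma tri_zero: "x \<in> out -` N \<Longrightarrow> k \<in> outs \<Longrightarrow> comp k 0 (\<Gamma> x) = 0"
  using tri unfolding triangular_on_def by blast

lemma tri_cong:
  "x \<in> out -` N \<Longrightarrow> y \<in> out -` N \<Longrightarrow> m < v \<Longrightarrow>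
    (\<And>k l. k \<in> outs \<Longrightarrow> l < m \<Longrightarrow> comp k l x = comp k l y) \<Longrightarrow> k \<in> outs \<Longrightarrow>
    comp k m (\<Gamma> x) = comp k m (\<Gamma> y)"
  using tri unfolding triangular_on_def by blast

text \<open>The perturbation leaves block 0 alone, which keeps all iterates in the cylinder on which
  \<open>\<Gamma>\<close> is controlled.\<close>

lemma out_tri_add: "x \<in> out -` N \<Longrightarrow> out (y + \<Gamma> x) = out y"
  by (simp add: out_eq_iff comp_linear tri_zero)

lemma out_tri_inverse: "y \<in> out -` N \<Longrightarrow> out (tri_inverse \<Gamma> j y) = out y"
  by (induction j) (simp_all add: tri_inverse_simps out_tri_add)

lemma tri_inverse_in: "y \<in> out -` N \<Longrightarrow> tri_inverse \<Gamma> j y \<in> out -` N"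
  by (simp add: out_tri_inverse)

lemma smooth_on_tri_inverse: "smooth_on (out -` N) (tri_inverse \<Gamma> j)"
proof (induction j)
  case 0
  show ?case
    unfolding tri_inverse_simps(1)[abs_def] by (rule smooth_on_bounded_linear[OF bounded_linear_ident])
next
  case (Suc j)
  show ?case
    unfolding tri_inverse_simps(2)[abs_def]
    by (intro smooth_on_add open_cylinder smooth_on_bounded_linear[OF bounded_linear_ident]
        smooth_on_compose[OF open_cylinder smooth Suc] image_subsetI tri_inverse_in)
qed

text \<open>Block \<open>l\<close> of \<open>\<Gamma>\<close> sees only the blocks below
  \<open>l\<close>, and these have already stopped changing one step earlier.\<close>

lemma tri_inverse_stable:
  assumes y: "y \<in> out -` N"
  shows "k \<in> outs \<Longrightarrow> l < v \<Longrightarrow> l \<le> j \<Longrightarrow>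
    comp k l (tri_inverse \<Gamma> (Suc j) y) = comp k l (tri_inverse \<Gamma> j y)"
proof (induction j arbitrary: k l)
  case 0
  then show ?case using y by (simp add: tri_inverse_simps comp_linear tri_zero)
next
  case (Suc j)
  have "comp k l (\<Gamma> (tri_inverse \<Gamma> (Suc j) y)) = comp k l (\<Gamma> (tri_inverse \<Gamma> j y))"
    using Suc by (intro tri_cong tri_inverse_in y) auto
  then show ?case
    unfolding tri_inverse_simps(2)[of _ "Suc j"] tri_inverse_simps(2)[of _ j] by (simp add: comp_linear)
qed

text \<open>All \<open>v\<close> blocks are stable after \<open>v\<close> steps, so the iterate is a
  fixed point of the iteration.\<close>

lemma tri_inverse_right: "y \<in> out -` N \<Longrightarrow> tri_inverse \<Gamma> v y - \<Gamma> (tri_inverse \<Gamma> v y) = y"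
proof -
  assume y: "y \<in> out -` N"
  have "tri_inverse \<Gamma> (Suc v) y = tri_inverse \<Gamma> v y"
    by (rule comp_eqI) (simp add: tri_inverse_stable[OF y])
  then show ?thesis by (simp add: tri_inverse_simps(2) algebra_simps)
qed

text \<open>Here \<open>x\<close> is itself a fixed point of the iteration for
  \<open>y = x - \<Gamma> x\<close>; the iterates are compared with it block by block.\<close>

lemma tri_inverse_left:
  assumes x: "x \<in> out -` N"
  shows "tri_inverse \<Gamma> v (x - \<Gamma> x) = x"
proof (rule comp_eqI)
  have xN: "x - \<Gamma> x \<in> out -` N"
    using x out_tri_add[OF x, of "x - \<Gamma> x"] by simp
  have "comp k l (tri_inverse \<Gamma> j (x - \<Gamma> x)) = comp k l x" if "k \<in> outs" "l < v" "l \<le> j" for k l j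
    using that
  proof (induction j arbitrary: k l)
    case 0
    then show ?case using x by (simp add: tri_inverse_simps comp_linear tri_zero)
  next
    case (Suc j)
    have "comp k l (\<Gamma> (tri_inverse \<Gamma> j (x - \<Gamma> x))) = comp k l (\<Gamma> x)"
      using Suc by (intro tri_cong tri_inverse_in xN x) auto
    then show ?case by (simp add: tri_inverse_simps comp_linear)
  qed
  then show "comp k l (tri_inverse \<Gamma> v (x - \<Gamma> x)) = comp k l x" if "k \<in> outs" "l < v" for k l
    using that by simp
qed

text \<open>The inverse is taken on the whole flipped cylinder, because the iterates for points of
  the image of \<open>W\<close> may leave \<open>W\<close>; \<open>diffeo_onI\<close> then restricts
  it.\<close>

lemma diffeo_on_flip_triangular:
  assumes W: "open W" "W \<subseteq> out -` N"
  shows "diffeo_on W (\<lambda>x. flip (x - \<Gamma> x))"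
proof (rule diffeo_onI[where Y = "flip -` (out -` N)" and S = "\<lambda>y. tri_inverse \<Gamma> v (flip y)"])
  show "smooth_on W (\<lambda>x. flip (x - \<Gamma> x))"
    by (intro smooth_on_linear_compose[OF W(1) bounded_linear_flip] smooth_on_diff W(1)
        smooth_on_bounded_linear[OF bounded_linear_ident] smooth_on_subset[OF smooth W(2)])
  show Y: "open (flip -` (out -` N))"
    using open_cylinder bounded_linear_flip by (simp add: open_vimage linear_continuous_on)
  show "smooth_on (flip -` (out -` N)) (\<lambda>y. tri_inverse \<Gamma> v (flip y))"
    by (rule smooth_on_compose[OF Y smooth_on_tri_inverse smooth_on_bounded_linear[OF bounded_linear_flip]]) auto
  show "(\<lambda>x. flip (x - \<Gamma> x)) ` W \<subseteq> flip -` (out -` N)"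
  proof clarsimp
    fix x assume "x \<in> W"
    then have x: "x \<in> out -` N" using W by auto
    then show "out (flip (flip (x - \<Gamma> x))) \<in> N"
      using out_tri_add[OF x, of "x - \<Gamma> x"] by (simp add: flip_flip)
  qed
qed (use W in \<open>auto simp: flip_flip tri_inverse_left tri_inverse_right subset_iff\<close>)

end

text \<open>
  In the transformed coordinates, block \<open>v - 1 - m\<close> is the \<open>m\<close>-th derivative of the output
  minus \<open>partial_form B m\<close>; for \<open>m = v\<close> the latter is the complete right-hand side.
\<close>

definition partial_form :: "(nat \<Rightarrow> 'w rvec \<Rightarrow> 'w rvec) \<Rightarrow> nat \<Rightarrow> 'n rvec \<Rightarrow> 'w rvec"
  where "partial_form B m x = (\<Sum>i=1..m. (D ^^ (m - i)) (\<lambda>x. B (v - i) (out x)) x)"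

definition ocf_shift :: "(nat \<Rightarrow> 'w rvec \<Rightarrow> 'w rvec) \<Rightarrow> 'n rvec \<Rightarrow> 'n rvec"
  where "ocf_shift B x = mkvec (\<lambda>i. partial_form B (hat v i) x $$ blk v i)"

lemma comp_ocf_shift:
  "k \<in> outs \<Longrightarrow> l < v \<Longrightarrow> comp k l (ocf_shift B x) = partial_form B l x $$ k"
  by (simp add: ocf_shift_def comp_mkvec blk_sidx hat_sidx)

context
  fixes N :: "'w rvec set" and B :: "nat \<Rightarrow> 'w rvec \<Rightarrow> 'w rvec"
  assumes N: "open N" and B: "\<And>r. r < v \<Longrightarrow> smooth_on N (B r)"
begin

lemma basic_on_B: "r < v \<Longrightarrow> basic_on (out -` N) (\<lambda>x. B r (out x))"
  by (rule basic_on_out[OF N B open_vimage[OF N]])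
    (auto intro: linear_continuous_on bounded_linear_out)

lemma smooth_on_form_term: "r < v \<Longrightarrow> smooth_on (out -` N) ((D ^^ m) (\<lambda>x. B r (out x)))"
  using basic_on_B open_vimage[OF N linear_continuous_on[OF bounded_linear_out]]
  by (intro smooth_on_D_pow) (auto simp: basic_on_def)

lemma open_Z: "open (out -` N)"
  by (rule open_vimage[OF N linear_continuous_on[OF bounded_linear_out]])

lemma smooth_on_partial_form: "smooth_on (out -` N) (partial_form B m)"
  unfolding partial_form_def[abs_def]
  by (intro smooth_on_sum[OF open_Z] smooth_on_form_term) (use v_pos in auto)

lemma smooth_on_ocf_shift: "smooth_on (out -` N) (ocf_shift B)"
  by (intro smooth_on_compI open_Z)
    (simp add: comp_ocf_shift smooth_on_linear_compose[OF open_Z bounded_linear_coord smooth_on_partial_form])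

text \<open>Each summand of \<open>partial_form B m\<close> is a power of \<open>D\<close> with
  exponent \<open>m - i < m\<close>, so by \<open>pd_D_pow\<close> its derivatives of index at least
  \<open>m\<close> vanish. Two states agreeing in the blocks below \<open>m\<close> can thus be
  joined by a segment on which it is constant.\<close>

lemma triangular_on_ocf_shift: "triangular_on (out -` N) (ocf_shift B)"
  unfolding triangular_on_def
proof (intro conjI ballI allI impI)
  show "comp k 0 (ocf_shift B x) = 0" if "k \<in> outs" for x k
    using that v_pos by (simp add: comp_ocf_shift partial_form_def coord_def)
  fix x y m k
  assume xy: "x \<in> out -` N" "y \<in> out -` N" and m: "m < v" and k: "k \<in> outs"
    and eq: "\<forall>k\<in>outs. \<forall>l<m. comp k l x = comp k l y"
  have "(D ^^ (m - i)) (\<lambda>x. B (v - i) (out x)) x = (D ^^ (m - i)) (\<lambda>x. B (v - i) (out x)) y"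
    if i: "i \<in> {1..m}" for i
  proof (rule eq_if_ddir_zero_on_segment[where F = "(D ^^ (m - i)) (\<lambda>x. B (v - i) (out x))"])
    let ?F = "(D ^^ (m - i)) (\<lambda>x. B (v - i) (out x))"
    fix z assume "z \<in> closed_segment x y"
    then obtain t where t: "z = x + t *\<^sub>R (y - x)"
      by (auto simp: in_segment algebra_simps)
    \<comment> \<open>The range of \<open>i\<close> forces \<open>m\<close> to be positive, so block
      0 is among the blocks that agree and the segment stays over one output value.\<close>
    have "out z = out x"
      using eq i unfolding out_eq_iff t by (auto simp: comp_linear)
    then have z: "z \<in> out -` N" using xy by simp
    have vi: "v - i < v" using i v_pos by auto
    from smooth_on_differentiable[OF smooth_on_form_term[OF vi] z]
    show dz: "?F differentiable (at z)" .
    have summand: "comp k l (y - x) *\<^sub>R pd k l ?F z = 0" if "k \<in> outs" "l < v" for k l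
    proof (cases "l < m")
      case True
      then show ?thesis using eq that by (simp add: comp_linear)
    next
      case False
      then have "(m - i) choose l = 0" using i by (auto simp: binomial_eq_0)
      then show ?thesis
        using pd_D_pow[OF open_Z basic_on_B[OF vi] that z, of "m - i"] by simp
    qed
    show "ddir (y - x) ?F z = 0"
      unfolding ddir_expansion[OF dz, of "y - x"] by (intro sum.neutral ballI) (rule summand, auto)
  qed
  then show "comp k m (ocf_shift B x) = comp k m (ocf_shift B y)"
    using k m by (simp add: comp_ocf_shift partial_form_def)
qed

text \<open>Differentiation along the system raises each power of \<open>D\<close> by one; the
  summand still missing for \<open>Suc m\<close> is the one with \<open>i = Suc m\<close>, an
  undifferentiated coefficient.\<close>

lemma ddir_partial_form:
  assumes x: "x \<in> out -` N" and m: "m < v"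
  shows "ddir (high_order_field v (p :: 'n rvec \<Rightarrow> 'w rvec) x) (partial_form B m) x + B (v - Suc m) (out x) =
    partial_form B (Suc m) x"
proof -
  let ?b = "\<lambda>i x. B (v - i) (out x)" and ?u = "high_order_field v p x"
  have "ddir ?u (partial_form B m) x = (\<Sum>i=1..m. ddir ?u ((D ^^ (m - i)) (?b i)) x)"
    unfolding partial_form_def[abs_def]
    by (intro ddir_sum smooth_on_differentiable[OF smooth_on_form_term x]) (use v_pos in auto)
  also have "\<dots> = (\<Sum>i=1..m. (D ^^ (Suc m - i)) (?b i) x)"
  proof (rule sum.cong[OF refl])
    fix i assume i: "i \<in> {1..m}"
    then have "v - i < v" "m - i < v - 1" "Suc m - i = Suc (m - i)" using v_pos m by auto
    then show "ddir ?u ((D ^^ (m - i)) (?b i)) x = (D ^^ (Suc m - i)) (?b i) x"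
      using ddir_high_order_field[OF open_Z x basic_on_B] by simp
  qed
  finally show ?thesis by (simp add: partial_form_def)
qed

lemma transformable_to_ocf_if_fully_measured:
  fixes p :: "'n rvec \<Rightarrow> 'w rvec"
  assumes W: "open W" and NW: "N = out ` W"
    and form: "\<And>x. x \<in> W \<Longrightarrow> p x = (\<Sum>r<v. (D ^^ r) (\<lambda>x. B r (out x)) x)"
  shows "transformable_to_ocf v W (high_order_field v p) (out :: 'n rvec \<Rightarrow> 'w rvec)"
  unfolding transformable_to_ocf_def
proof (intro exI conjI ballI)
  let ?T = "\<lambda>x. flip (x - ocf_shift B x)"
  \<comment> \<open>Entry \<open>l\<close> belongs to the derivative order
    \<open>m = v - 1 - l\<close>, for which \<open>ddir_partial_form\<close> leaves over
    \<open>B (v - Suc m) = B l\<close>.\<close>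
  let ?\<alpha> = "\<lambda>c. mkvec (\<lambda>i. B (hat v i) c $$ blk v i) :: 'n rvec"
  have WZ: "W \<subseteq> out -` N" using NW by auto
  show T: "diffeo_on W ?T"
    by (rule diffeo_on_flip_triangular[OF N smooth_on_ocf_shift triangular_on_ocf_shift W WZ])
  show "open (out ` W)" using N NW by simp
  show "smooth_on (out ` W) ?\<alpha>"
    unfolding NW[symmetric]
  proof (rule smooth_on_compI[OF N])
    show "smooth_on N (\<lambda>c. comp k l (?\<alpha> c))" if "k \<in> outs" "l < v" for k l
      using that by (simp add: comp_mkvec blk_sidx hat_sidx
          smooth_on_linear_compose[OF N bounded_linear_coord B])
  qed
  have comp_T: "comp k l (?T x) = comp k (v - 1 - l) x - partial_form B (v - 1 - l) x $$ k"
    if "k \<in> outs" "l < v" for k l x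
    using that by (simp add: comp_flip comp_linear comp_ocf_shift)
  fix x assume x: "x \<in> W"
  then have xZ: "x \<in> out -` N" using WZ by auto
  show "out x = ocf_C v *v ?T x"
  proof (rule coord_eqI)
    fix k assume "k \<in> {1..CARD('w)}"
    then have k: "k \<in> outs" by (simp add: w)
    show "out x $$ k = ((ocf_C v :: ('n rvec, 'w) vec) *v ?T x) $$ k"
      unfolding coord_ocf_C[OF k] out_coord[OF k] using k v_pos
      by (simp add: comp_T partial_form_def) (simp add: coord_def)
  qed
  \<comment> \<open>This closes the chain: the time derivative of order \<open>v\<close> equals
    \<open>p\<close>, so subtracting the complete form leaves nothing but the output injection in
    entry 0.\<close>
  have p_form: "p x = partial_form B v x"
    unfolding form[OF x] partial_form_def
    by (rule sum.reindex_bij_witness[of _ "\<lambda>i. v - i" "\<lambda>i. v - i"]) auto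
  let ?u = "high_order_field v p x"
  have dT: "?T differentiable (at x)"
    using T x unfolding diffeo_on_def by (blast intro: smooth_on_differentiable)
  show "frechet_derivative ?T (at x) ?u = ocf_A v *v ?T x + ?\<alpha> (out x)"
  proof (rule comp_eqI)
    fix k l assume k: "k \<in> outs" and l: "l < v"
    define m where "m = v - 1 - l"
    have m: "m < v" "v - Suc m = l" using l by (auto simp: m_def)
    note dG = smooth_on_differentiable[OF smooth_on_partial_form xZ]
    have "comp k l (frechet_derivative ?T (at x) ?u) = ddir ?u (\<lambda>x. comp k l (?T x)) x"
      by (subst ddir_linear_compose[OF bounded_linear_comp dT]) (simp add: ddir_def)
    also have "(\<lambda>x. comp k l (?T x)) = (\<lambda>x. comp k m x - partial_form B m x $$ k)"
      using k l by (simp add: comp_T m_def)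
    also have "ddir ?u (\<lambda>x. comp k m x - partial_form B m x $$ k) x =
        comp k m ?u - ddir ?u (partial_form B m) x $$ k"
      using bounded_linear_imp_differentiable[OF bounded_linear_comp]
      by (subst ddir_diff) (auto simp: ddir_bounded_linear bounded_linear_comp
          ddir_linear_compose[OF bounded_linear_coord dG]
          intro!: differentiable_compose[OF bounded_linear_imp_differentiable[OF bounded_linear_coord] dG])
    also have "ddir ?u (partial_form B m) x = partial_form B (Suc m) x - B l (out x)"
      using ddir_partial_form[OF xZ m(1), of p] m(2) by (simp add: algebra_simps)
    also have "comp k m ?u - (partial_form B (Suc m) x - B l (out x)) $$ k =
        comp k l (ocf_A v *v ?T x + ?\<alpha> (out x))"
    proof (cases "l = 0")
      case True
      then have "m = v - 1" "Suc m = v" using v_pos by (auto simp: m_def)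
      then show ?thesis
        using True k l m p_form blk_sidx[of 0 v k] hat_sidx[of 0 v k]
        by (simp add: comp_linear comp_ocf_A comp_mkvec blk_sidx hat_sidx comp_high_order_field)
          (simp add: coord_def)
    next
      case False
      \<comment> \<open>The next derivative minus its partial form is entry \<open>l - 1\<close> of
        \<open>?T x\<close>, which is what the subdiagonal of the matrix passes on.\<close>
      then have "m < v - 1" "v - 1 - (l - 1) = Suc m" using l by (auto simp: m_def)
      then show ?thesis
        using False k l m
        by (simp add: comp_linear comp_ocf_A comp_T comp_mkvec blk_sidx hat_sidx comp_high_order_field)
          (simp add: coord_def)
    qed
    finally show "comp k l (frechet_derivative ?T (at x) ?u) = comp k l (ocf_A v *v ?T x + ?\<alpha> (out x))" .
  qed
qed

end

end

section \<open>Potentials of closed 1-forms along polylines\<close>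

text \<open>Differentiation under the integral sign gives derivatives along lines only. The mean
  value theorem on the segment from \<open>c\<close> to \<open>y\<close> writes the increment with
  the gradient at an intermediate point, and continuity of \<open>g\<close> controls the
  error.\<close>

lemma has_derivative_if_continuous_gateaux:
  fixes \<Phi> :: "'a::real_inner \<Rightarrow> real"
  assumes N: "open N" "c \<in> N" and g: "continuous_on N g"
    and d: "\<And>c u. c \<in> N \<Longrightarrow> ((\<lambda>\<epsilon>. \<Phi> (c + \<epsilon> *\<^sub>R u)) has_real_derivative g c \<bullet> u) (at 0)"
  shows "(\<Phi> has_derivative (\<lambda>u. g c \<bullet> u)) (at c)"
  unfolding has_derivative_at_alt
proof (intro conjI allI impI)
  show "bounded_linear (\<lambda>u. g c \<bullet> u)" by (rule bounded_linear_inner_right)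
  fix e :: real assume "e > 0"
  obtain r where r: "r > 0" "ball c r \<subseteq> N" using N openE by blast
  have "continuous (at c) g" using g N by (simp add: continuous_on_eq_continuous_at)
  then obtain s where s: "s > 0" "\<And>y. dist y c < s \<Longrightarrow> dist (g y) (g c) < e"
    using \<open>e > 0\<close> unfolding continuous_at_eps_delta by blast
  have "norm (\<Phi> y - \<Phi> c - g c \<bullet> (y - c)) \<le> e * norm (y - c)" if y: "norm (y - c) < min r s" for y
  proof -
    have near: "norm (t *\<^sub>R (y - c)) \<le> norm (y - c)" if "0 \<le> t" "t \<le> 1" for t :: real
      using that mult_right_mono[of t 1 "norm (y - c)"] by simp
    have "((\<lambda>t. \<Phi> (c + t *\<^sub>R (y - c))) has_real_derivative g (c + t *\<^sub>R (y - c)) \<bullet> (y - c)) (at t)"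
      if "0 \<le> t" "t \<le> 1" for t :: real
    proof -
      have "c + t *\<^sub>R (y - c) \<in> ball c r"
        using near[OF that] y by (simp add: dist_norm)
      then have "c + t *\<^sub>R (y - c) \<in> N" using r by blast
      \<comment> \<open>The hypothesis speaks of the parameter 0 only; moving the base point along
        the line gives the derivative at \<open>t\<close>.\<close>
      from d[OF this, of "y - c"]
      have "((\<lambda>\<epsilon>. \<Phi> (c + (\<epsilon> + t) *\<^sub>R (y - c))) has_real_derivative g (c + t *\<^sub>R (y - c)) \<bullet> (y - c)) (at 0)"
        by (simp add: algebra_simps)
      then show ?thesis
        using DERIV_shift[of "\<lambda>s. \<Phi> (c + s *\<^sub>R (y - c))" _ 0 t] by simp
    qed
    from MVT2[OF zero_less_one this] obtain t where t: "0 < t" "t < 1"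
      and eq: "\<Phi> y - \<Phi> c = g (c + t *\<^sub>R (y - c)) \<bullet> (y - c)"
      by auto
    have "dist (c + t *\<^sub>R (y - c)) c < s"
      using near[of t] t y by (simp add: dist_norm)
    then have "norm (g (c + t *\<^sub>R (y - c)) - g c) \<le> e"
      using s(2)[of "c + t *\<^sub>R (y - c)"] by (simp add: dist_norm)
    then have "norm (g (c + t *\<^sub>R (y - c)) - g c) * norm (y - c) \<le> e * norm (y - c)"
      by (rule mult_right_mono) simp
    moreover have "norm (\<Phi> y - \<Phi> c - g c \<bullet> (y - c)) \<le> norm (g (c + t *\<^sub>R (y - c)) - g c) * norm (y - c)"
      unfolding eq inner_diff_left[symmetric] real_norm_def by (rule Cauchy_Schwarz_ineq2)
    ultimately show ?thesis by linarith
  qed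
  then show "\<exists>d>0. \<forall>y. norm (y - c) < d \<longrightarrow> norm (\<Phi> y - \<Phi> c - g c \<bullet> (y - c)) \<le> e * norm (y - c)"
    using r s by (intro exI[of _ "min r s"]) auto
qed

lemma sum_UNIV_idx: "(\<Sum>k\<in>UNIV. f (k::'m::{finite,linorder})) = (\<Sum>i=1..CARD('m). f (idx i))"
  by (rule sum.reindex_bij_witness[of _ idx pos])
    (use range_pos[where 'n='m] in \<open>auto simp: idx_pos pos_idx\<close>)

lemma coord_algebra:
  fixes x y :: "'m::{finite,linorder} rvec"
  shows "(x + y) $$ i = x $$ i + y $$ i" "(r *\<^sub>R x) $$ i = r * x $$ i" "(0 :: 'm rvec) $$ i = 0"
    "(\<Sum>a\<in>A. f a :: 'm rvec) $$ i = (\<Sum>a\<in>A. f a $$ i)"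
  by (simp_all add: coord_def)

lemma inner_coord: "x \<bullet> y = (\<Sum>i=1..CARD('m). x $$ i * y $$ i)" for x y :: "'m::{finite,linorder} rvec"
  by (simp add: inner_vec_def sum_UNIV_idx coord_def)

lemma coord_expansion:
  "x = (\<Sum>i=1..CARD('m). x $$ i *\<^sub>R axis (idx i) 1)" for x :: "'m::{finite,linorder} rvec"
proof (rule coord_eqI)
  fix j assume j: "j \<in> {1..CARD('m)}"
  have "(\<Sum>i=1..CARD('m). x $$ i *\<^sub>R (axis (idx i) 1 :: 'm rvec)) $$ j =
      (\<Sum>i=1..CARD('m). x $$ i * (axis (idx i) 1 :: 'm rvec) $$ j)"
    by (simp add: coord_algebra)
  also have "\<dots> = (\<Sum>i=1..CARD('m). if i = j then x $$ j else 0)"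
    using j by (intro sum.cong refl) (simp add: coord_axis del: atLeastAtMost_iff)
  finally show "x $$ j = (\<Sum>i=1..CARD('m). x $$ i *\<^sub>R (axis (idx i) 1 :: 'm rvec)) $$ j" using j by simp
qed

lemma ddir_coord_expansion:
  fixes F :: "'m::{finite,linorder} rvec \<Rightarrow> 'b::real_normed_vector"
  assumes "F differentiable (at x)"
  shows "ddir u F x = (\<Sum>i=1..CARD('m). u $$ i *\<^sub>R ddir (axis (idx i) 1) F x)"
proof -
  note L = linear_ddir[OF assms]
  have "ddir u F x = ddir (\<Sum>i=1..CARD('m). u $$ i *\<^sub>R axis (idx i) 1) F x"
    using coord_expansion[of u] by simp
  then show ?thesis by (simp add: linear_sum[OF L] linear_scale[OF L])
qed

text \<open>
  The integration path from \<open>0\<close> to \<open>c\<close> is the polyline changing one component at a time;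
  \<open>leg j t c\<close> is the point at parameter \<open>t\<close> of its \<open>j\<close>-th leg.
\<close>

definition leg :: "nat \<Rightarrow> real \<Rightarrow> 'm::{finite,linorder} rvec \<Rightarrow> 'm rvec"
  where "leg j t c = set_comp j (t * c $$ j) (keep_first j c)"

lemma coord_leg:
  "i \<in> {1..CARD('m)} \<Longrightarrow> leg j t (c :: 'm::{finite,linorder} rvec) $$ i =
    (if i < j then c $$ i else if i = j then t * c $$ j else 0)"
  by (simp add: leg_def set_comp_def keep_first_def coord_mkvec)

lemma leg_affine: "j \<in> {1..CARD('m)} \<Longrightarrow>
    leg j t c = leg j 0 c + t *\<^sub>R (c $$ j *\<^sub>R axis (idx j) 1)" for c :: "'m::{finite,linorder} rvec"
  by (rule coord_eqI) (simp add: coord_leg coord_axis coord_algebra del: atLeastAtMost_iff)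

lemma linear_leg: "linear (leg j t)"
  by (rule linearI; rule coord_eqI) (simp_all add: coord_leg coord_algebra algebra_simps)

lemma bounded_linear_leg: "bounded_linear (leg j t)"
  using linear_leg linear_conv_bounded_linear by blast

lemma leg_0: "leg j 0 c = keep_first (j - 1) c" if "j \<in> {1..CARD('m)}" for c :: "'m::{finite,linorder} rvec"
  using that by (intro coord_eqI) (auto simp: coord_leg keep_first_def coord_mkvec)

lemma leg_1: "leg j 1 c = keep_first j c" if "j \<in> {1..CARD('m)}" for c :: "'m::{finite,linorder} rvec"
  using that by (intro coord_eqI) (auto simp: coord_leg keep_first_def coord_mkvec)

lemma keep_first_all: "keep_first CARD('m) c = c" for c :: "'m::{finite,linorder} rvec"
  by (intro coord_eqI) (auto simp: keep_first_def coord_mkvec)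

lemma keep_first_0: "keep_first 0 c = (0 :: 'm::{finite,linorder} rvec)"
  by (intro coord_eqI) (simp add: keep_first_def coord_mkvec coord_algebra)

text \<open>The integral formula for \<open>B r c $$ k\<close> with general integrands. The
  integrals are signed, so negative components are included.\<close>

definition path_integral :: "(nat \<Rightarrow> 'm::{finite,linorder} rvec \<Rightarrow> real) \<Rightarrow> 'm rvec \<Rightarrow> real"
  where "path_integral P c =
    (\<Sum>j=1..CARD('m). LBINT s=0..c $$ j. P j (set_comp j s (keep_first j c)))"

text \<open>Closedness is used only at points of the legs, so \<open>path\<close> takes the place of
  convexity of \<open>N\<close>.\<close>

locale closed_form =
  fixes N :: "'m::{finite,linorder} rvec set" and P :: "nat \<Rightarrow> 'm rvec \<Rightarrow> real"
  assumes N: "open N"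
    and path: "\<And>c j s. c \<in> N \<Longrightarrow> j \<in> {1..CARD('m)} \<Longrightarrow> s \<in> closed_segment 0 (c $$ j) \<Longrightarrow>
      set_comp j s (keep_first j c) \<in> N"
    and smooth_P: "\<And>j. j \<in> {1..CARD('m)} \<Longrightarrow> smooth_on N (P j)"
    and closed: "\<And>c i j. c \<in> N \<Longrightarrow> i \<in> {1..CARD('m)} \<Longrightarrow> j \<in> {1..CARD('m)} \<Longrightarrow>
      ddir (axis (idx i) 1) (P j) c = ddir (axis (idx j) 1) (P i) c"
begin

lemma leg_in: "c \<in> N \<Longrightarrow> j \<in> {1..CARD('m)} \<Longrightarrow> 0 \<le> t \<Longrightarrow> t \<le> 1 \<Longrightarrow> leg j t c \<in> N"
  unfolding leg_def by (rule path) (auto simp: in_segment)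

lemma continuous_on_leg: "continuous_on S (\<lambda>z. leg j (a z) (b z))" if "j \<in> {1..CARD('m)}"
    "continuous_on S a" "continuous_on S (b :: 'z::topological_space \<Rightarrow> 'm rvec)"
proof -
  have eq: "leg j (a z) (b z) = leg j 0 (b z) + a z *\<^sub>R (b z $$ j *\<^sub>R axis (idx j) 1)" for z
    by (rule leg_affine[OF that(1)])
  show ?thesis
    unfolding eq
    by (intro continuous_intros that bounded_linear.continuous_on[OF bounded_linear_leg]
        bounded_linear.continuous_on[OF bounded_linear_coord])
qed

text \<open>The derivative of \<open>c $$ j * P j (leg j t c)\<close> in \<open>c\<close> along
  \<open>u\<close>; as \<open>leg j t\<close> is linear, the point of evaluation moves along
  \<open>leg j t u\<close>.\<close>

definition leg_integrand :: "nat \<Rightarrow> real \<Rightarrow> 'm rvec \<Rightarrow> 'm rvec \<Rightarrow> real"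
  where "leg_integrand j t c u = u $$ j * P j (leg j t c) +
    c $$ j * (\<Sum>i\<in>{1..CARD('m)}. leg j t u $$ i * ddir (axis (idx i) 1) (P j) (leg j t c))"

text \<open>The substitution s = t * c_j makes the limits independent of \<open>c\<close>.\<close>

lemma interval_integral_leg:
  assumes c: "c \<in> N" and j: "j \<in> {1..CARD('m)}"
  shows "(LBINT s=0..c $$ j. P j (set_comp j s (keep_first j c))) =
    integral {0..1} (\<lambda>t. c $$ j * P j (leg j t c))"
proof -
  have "continuous_on ((\<lambda>t. t * c $$ j) ` {0..1}) (\<lambda>s. P j (set_comp j s (keep_first j c)))"
  proof (rule continuous_on_compose2[OF smooth_on_continuous_on[OF smooth_P[OF j]]])
    have j1: "j \<ge> 1" using j by simp
    have "set_comp j s (keep_first j c) = keep_first (j - 1) c + s *\<^sub>R axis (idx j) 1" for s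
      using j j1 by (intro coord_eqI) (auto simp: set_comp_def keep_first_def coord_mkvec coord_axis
          coord_algebra simp del: atLeastAtMost_iff)
    then show "continuous_on ((\<lambda>t. t * c $$ j) ` {0..1}) (\<lambda>s. set_comp j s (keep_first j c))"
      by (simp add: continuous_intros)
    show "(\<lambda>s. set_comp j s (keep_first j c)) ` (\<lambda>t. t * c $$ j) ` {0..1} \<subseteq> N"
      using leg_in[OF c j] by (auto simp: leg_def)
  qed
  from interval_integral_substitution_finite[OF zero_le_one _ this continuous_on_const]
  have "(LBINT s=0..c $$ j. P j (set_comp j s (keep_first j c))) =
      (LBINT t=0..1. c $$ j * P j (leg j t c))"
    using DERIV_cmult_right[OF DERIV_ident, of "c $$ j"]
    by (simp add: leg_def zero_ereal_def one_ereal_def)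
  also have "\<dots> = integral {0..1} (\<lambda>t. c $$ j * P j (leg j t c))"
  proof -
    have "continuous_on {0..1} (\<lambda>t. c $$ j * P j (leg j t c))"
      by (intro continuous_intros continuous_on_compose2[OF smooth_on_continuous_on[OF smooth_P[OF j]]]
          continuous_on_leg j) (auto intro: leg_in c j)
    from interval_integral_eq_integral[OF zero_le_one borel_integrable_atLeastAtMost'[OF this]]
    show ?thesis by (simp add: zero_ereal_def one_ereal_def)
  qed
  finally show ?thesis .
qed

text \<open>By closedness the integrand is the exact \<open>t\<close>-derivative of the 1-form at
  \<open>leg j t c\<close> applied to the vector \<open>leg j t u\<close>, so only the two ends of
  the leg contribute.\<close>

lemma integral_leg_integrand:
  assumes c: "c \<in> N" and j: "j \<in> {1..CARD('m)}"
  shows "integral {0..1} (\<lambda>t. leg_integrand j t c u) =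
    (\<Sum>i\<in>{1..CARD('m)}. keep_first j u $$ i * P i (keep_first j c)) -
    (\<Sum>i\<in>{1..CARD('m)}. keep_first (j - 1) u $$ i * P i (keep_first (j - 1) c))"
proof -
  let ?R = "\<lambda>t. \<Sum>i\<in>{1..CARD('m)}. leg j t u $$ i * P i (leg j t c)"
  have "(?R has_real_derivative leg_integrand j t c u) (at t)" if t: "t \<in> {0..1}" for t
  proof -
    have dP: "((\<lambda>t. P i (leg j t c)) has_real_derivative
        c $$ j * ddir (axis (idx i) 1) (P j) (leg j t c)) (at t)" if i: "i \<in> {1..CARD('m)}" for i
    proof -
      have "leg j t c \<in> N" using t leg_in[OF c j] by simp
      note d = smooth_on_differentiable[OF smooth_P[OF i] this]
      have "ddir (c $$ j *\<^sub>R axis (idx j) 1) (P i) (leg j t c) =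
          c $$ j * ddir (axis (idx i) 1) (P j) (leg j t c)"
        using linear_scale[OF linear_ddir[OF d]] closed[OF \<open>leg j t c \<in> N\<close> j i] by simp
      then show ?thesis
        using has_real_derivative_along_line[of "P i" "leg j 0 c" t "c $$ j *\<^sub>R axis (idx j) 1"] d
        unfolding leg_affine[OF j, symmetric] by simp
    qed
    have du: "((\<lambda>t. leg j t u $$ i) has_real_derivative (if i = j then u $$ j else 0)) (at t)"
      if "i \<in> {1..CARD('m)}" for i
      unfolding coord_leg[OF that]
      by (cases "i = j"; cases "i < j") (auto intro!: derivative_eq_intros)
    have "(?R has_real_derivative (\<Sum>i\<in>{1..CARD('m)}.
        leg j t u $$ i * (c $$ j * ddir (axis (idx i) 1) (P j) (leg j t c)) +
        (if i = j then u $$ j else 0) * P i (leg j t c))) (at t)"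
      by (intro DERIV_sum DERIV_mult' dP du)
    also have "(\<Sum>i\<in>{1..CARD('m)}. leg j t u $$ i * (c $$ j * ddir (axis (idx i) 1) (P j) (leg j t c)) +
        (if i = j then u $$ j else 0) * P i (leg j t c)) = leg_integrand j t c u"
      using j unfolding leg_integrand_def sum.distrib sum_distrib_left
      by (simp add: if_distrib[of "\<lambda>a. a * _"] mult.left_commute cong: if_cong)
    finally show ?thesis .
  qed
  then have "((\<lambda>t. leg_integrand j t c u) has_integral ?R 1 - ?R 0) {0..1}"
    by (intro fundamental_theorem_of_calculus)
      (auto simp: has_real_derivative_iff_has_vector_derivative[symmetric] intro: has_field_derivative_at_within)
  then show ?thesis
    using leg_0[OF j] leg_1[OF j] by (simp add: integral_unique)
qed

lemma path_integral_gateaux: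
  assumes c: "c \<in> N"
  shows "((\<lambda>\<epsilon>. path_integral P (c + \<epsilon> *\<^sub>R u)) has_real_derivative (\<Sum>j\<in>{1..CARD('m)}. P j c * u $$ j)) (at 0)"
proof -
  have "open ((\<lambda>\<epsilon>. c + \<epsilon> *\<^sub>R u) -` N)"
    by (intro open_vimage[OF N] continuous_intros)
  moreover have "0 \<in> (\<lambda>\<epsilon>. c + \<epsilon> *\<^sub>R u) -` N" using c by simp
  ultimately obtain r where r: "r > 0" "ball 0 r \<subseteq> (\<lambda>\<epsilon>. c + \<epsilon> *\<^sub>R u) -` N"
    by (rule openE)
  have inN: "c + \<epsilon> *\<^sub>R u \<in> N" if "\<epsilon> \<in> ball 0 r" for \<epsilon> using r that by auto
  have D: "((\<lambda>\<epsilon>. integral {0..1} (\<lambda>t. (c + \<epsilon> *\<^sub>R u) $$ j * P j (leg j t (c + \<epsilon> *\<^sub>R u))))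
      has_real_derivative integral {0..1} (\<lambda>t. leg_integrand j t c u)) (at 0)" if j: "j \<in> {1..CARD('m)}" for j
  proof -
    have "((\<lambda>\<epsilon>. integral (cbox 0 1) (\<lambda>t. (c + \<epsilon> *\<^sub>R u) $$ j * P j (leg j t (c + \<epsilon> *\<^sub>R u))))
      has_field_derivative integral (cbox 0 1) (\<lambda>t. leg_integrand j t (c + 0 *\<^sub>R u) u)) (at 0 within ball 0 r)"
    proof (rule leibniz_rule_field_derivative)
      show "((\<lambda>\<epsilon>. (c + \<epsilon> *\<^sub>R u) $$ j * P j (leg j t (c + \<epsilon> *\<^sub>R u))) has_field_derivative
          leg_integrand j t (c + \<epsilon> *\<^sub>R u) u) (at \<epsilon> within ball 0 r)"
        if "\<epsilon> \<in> ball 0 r" "t \<in> cbox 0 1" for \<epsilon> t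
      proof -
        have leg_N: "leg j t (c + \<epsilon> *\<^sub>R u) \<in> N" using leg_in[OF inN j] that by simp
        have leg_line: "leg j t (c + \<epsilon> *\<^sub>R u) = leg j t c + \<epsilon> *\<^sub>R leg j t u" for \<epsilon>
          by (simp add: linear_add[OF linear_leg] linear_scale[OF linear_leg])
        note d = smooth_on_differentiable[OF smooth_P[OF j] leg_N]
        have 1: "((\<lambda>\<epsilon>. (c + \<epsilon> *\<^sub>R u) $$ j) has_real_derivative u $$ j) (at \<epsilon>)"
          unfolding coord_def by (auto intro!: derivative_eq_intros)
        have 2: "((\<lambda>\<epsilon>. P j (leg j t (c + \<epsilon> *\<^sub>R u))) has_real_derivative
            (\<Sum>i\<in>{1..CARD('m)}. leg j t u $$ i * ddir (axis (idx i) 1) (P j) (leg j t (c + \<epsilon> *\<^sub>R u)))) (at \<epsilon>)"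
          using has_real_derivative_along_line[of "P j" "leg j t c" \<epsilon> "leg j t u"] d
            ddir_coord_expansion[OF d, of "leg j t u"] unfolding leg_line by simp
        have "((\<lambda>\<epsilon>. (c + \<epsilon> *\<^sub>R u) $$ j * P j (leg j t (c + \<epsilon> *\<^sub>R u))) has_real_derivative
            leg_integrand j t (c + \<epsilon> *\<^sub>R u) u) (at \<epsilon>)"
          using DERIV_mult'[OF 1 2] by (simp add: leg_integrand_def add.commute)
        then show ?thesis by (rule has_field_derivative_at_within)
      qed
      show "(\<lambda>t. (c + \<epsilon> *\<^sub>R u) $$ j * P j (leg j t (c + \<epsilon> *\<^sub>R u))) integrable_on cbox 0 1"
        if "\<epsilon> \<in> ball 0 r" for \<epsilon>
        by (intro integrable_continuous continuous_intros
            continuous_on_compose2[OF smooth_on_continuous_on[OF smooth_P[OF j]]] continuous_on_leg j)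
          (use leg_in[OF inN[OF that] j] in auto)
      show "continuous_on (ball 0 r \<times> cbox 0 1) (\<lambda>(\<epsilon>, t). leg_integrand j t (c + \<epsilon> *\<^sub>R u) u)"
        unfolding case_prod_unfold leg_integrand_def
        by (intro continuous_intros bounded_linear.continuous_on[OF bounded_linear_coord]
            continuous_on_compose2[OF smooth_on_continuous_on[OF smooth_P[OF j]]]
            continuous_on_compose2[OF smooth_on_continuous_on[OF smooth_on_ddir[OF smooth_P[OF j]]]] continuous_on_leg j)
          (use leg_in[OF inN j] in auto)
    qed (use r in auto)
    then show ?thesis using r by (simp add: at_within_open[of 0 "ball 0 r"])
  qed
  have "((\<lambda>\<epsilon>. \<Sum>j\<in>{1..CARD('m)}. integral {0..1} (\<lambda>t. (c + \<epsilon> *\<^sub>R u) $$ j * P j (leg j t (c + \<epsilon> *\<^sub>R u))))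
      has_real_derivative (\<Sum>j\<in>{1..CARD('m)}. integral {0..1} (\<lambda>t. leg_integrand j t c u))) (at 0)"
    by (intro DERIV_sum D)
  also have "(\<Sum>j\<in>{1..CARD('m)}. integral {0..1} (\<lambda>t. leg_integrand j t c u)) =
      (\<Sum>j\<in>{1..CARD('m)}. (\<Sum>i\<in>{1..CARD('m)}. keep_first j u $$ i * P i (keep_first j c)) -
        (\<Sum>i\<in>{1..CARD('m)}. keep_first (j - 1) u $$ i * P i (keep_first (j - 1) c)))"
    by (intro sum.cong refl integral_leg_integrand c)
  \<comment> \<open>The end of each leg is the start of the next, so the sum telescopes; at the
    initial point the vector \<open>keep_first 0 u\<close> is 0, which leaves the form at
    \<open>c\<close> itself.\<close>
  also have "\<dots> = (\<Sum>i\<in>{1..CARD('m)}. u $$ i * P i c)"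
    using sum_telescope''[of 0 "CARD('m)" "\<lambda>j. \<Sum>i\<in>{1..CARD('m)}. keep_first j u $$ i * P i (keep_first j c)"]
    by (simp add: keep_first_all keep_first_0 coord_algebra)
  finally have "((\<lambda>\<epsilon>. \<Sum>j\<in>{1..CARD('m)}. integral {0..1} (\<lambda>t. (c + \<epsilon> *\<^sub>R u) $$ j * P j (leg j t (c + \<epsilon> *\<^sub>R u))))
      has_real_derivative (\<Sum>j\<in>{1..CARD('m)}. P j c * u $$ j)) (at 0)"
    by (simp add: mult.commute)
  then show ?thesis
  proof (rule has_field_derivative_transform_within_open[of _ _ _ "ball 0 r"])
    show "(\<Sum>j\<in>{1..CARD('m)}. integral {0..1} (\<lambda>t. (c + \<epsilon> *\<^sub>R u) $$ j * P j (leg j t (c + \<epsilon> *\<^sub>R u)))) =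
        path_integral P (c + \<epsilon> *\<^sub>R u)" if "\<epsilon> \<in> ball 0 r" for \<epsilon>
      unfolding path_integral_def by (intro sum.cong refl interval_integral_leg[symmetric] inN that)
  qed (use r in auto)
qed

lemma has_derivative_path_integral:
  assumes "c \<in> N"
  shows "(path_integral P has_derivative (\<lambda>u. \<Sum>j\<in>{1..CARD('m)}. P j c * u $$ j)) (at c)"
proof -
  let ?g = "\<lambda>c. mkvec (\<lambda>j. P j c) :: 'm rvec"
  have inner_g: "?g c \<bullet> u = (\<Sum>j\<in>{1..CARD('m)}. P j c * u $$ j)" for c u
    unfolding inner_coord by (intro sum.cong refl) (simp add: coord_mkvec)
  have "continuous_on N ?g"
    unfolding mkvec_def
  proof (rule continuous_on_vec_lambda)
    show "continuous_on N (P (pos k))" for k :: 'm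
      using range_pos[where 'n='m] by (intro smooth_on_continuous_on smooth_P) blast
  qed
  from has_derivative_if_continuous_gateaux[OF N assms this, of "path_integral P"]
  show ?thesis unfolding inner_g using path_integral_gateaux by blast
qed

lemma ddir_path_integral: "c \<in> N \<Longrightarrow> ddir u (path_integral P) c = (\<Sum>j\<in>{1..CARD('m)}. P j c * u $$ j)"
  by (rule ddir_eq[OF has_derivative_path_integral])

lemma partial_path_integral:
  assumes "c \<in> N" "i \<in> {1..CARD('m)}"
  shows "ddir (axis (idx i) 1) (path_integral P) c = P i c"
proof -
  have "(\<Sum>j\<in>{1..CARD('m)}. P j c * (axis (idx i) 1 :: 'm rvec) $$ j) = (\<Sum>j\<in>{1..CARD('m)}. if j = i then P i c else 0)"
    using assms(2) by (intro sum.cong refl) (simp add: coord_axis del: atLeastAtMost_iff)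
  then show ?thesis unfolding ddir_path_integral[OF assms(1)] using assms(2) by simp
qed

lemma smooth_on_path_integral: "smooth_on N (path_integral P)"
  unfolding smooth_on_iff[of N "path_integral P"]
proof (intro conjI ballI allI)
  show "path_integral P differentiable (at c)" if "c \<in> N" for c
    using has_derivative_path_integral[OF that] by (auto simp: differentiable_def)
  show "smooth_on N (ddir u (path_integral P))" for u
  proof (rule smooth_on_cong[OF N, THEN iffD2])
    show "ddir u (path_integral P) c = (\<Sum>j\<in>{1..CARD('m)}. P j c * u $$ j)" if "c \<in> N" for c
      by (rule ddir_path_integral[OF that])
    show "smooth_on N (\<lambda>c. \<Sum>j\<in>{1..CARD('m)}. P j c * u $$ j)"
      by (intro smooth_on_sum[OF N] bounded_bilinear.smooth_on[OF bounded_bilinear_mult N] smooth_P smooth_on_const)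
  qed
qed

end

section \<open>The Pascal-Hessian condition and the fully measured form\<close>

text \<open>As in the chain rule, the direction \<open>f x\<close> varies with \<open>x\<close> and
  is expanded in a fixed basis.\<close>

lemma smooth_on_lie:
  fixes f :: "'a::euclidean_space \<Rightarrow> 'a"
  assumes S: "open S" and f: "smooth_on S f" and g: "smooth_on S g"
  shows "smooth_on S (lie f g)"
proof (rule smooth_on_cong[OF S, THEN iffD2])
  show "lie f g x = (\<Sum>b\<in>Basis. (f x \<bullet> b) *\<^sub>R ddir b g x)" if "x \<in> S" for x
  proof -
    note L = linear_ddir[OF smooth_on_differentiable[OF g that]]
    have "lie f g x = ddir (\<Sum>b\<in>Basis. (f x \<bullet> b) *\<^sub>R b) g x"
      by (simp add: lie_def ddir_def euclidean_representation)
    then show ?thesis by (simp add: linear_sum[OF L] linear_scale[OF L])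
  qed
  show "smooth_on S (\<lambda>x. \<Sum>b\<in>Basis. (f x \<bullet> b) *\<^sub>R ddir b g x)"
    by (intro smooth_on_sum[OF S] smooth_on_scaleR[OF S] smooth_on_ddir[OF g]
        smooth_on_linear_compose[OF S bounded_linear_inner_left f])
qed

lemma smooth_on_lie_pow:
  fixes f :: "'a::euclidean_space \<Rightarrow> 'a"
  shows "open S \<Longrightarrow> smooth_on S f \<Longrightarrow> smooth_on S g \<Longrightarrow> smooth_on S ((lie f ^^ m) g)"
  by (induction m) (simp_all add: smooth_on_lie)

context block_coordinates
begin

section \<open>The zero section and the coefficients on it\<close>

abbreviation emb :: "'w rvec \<Rightarrow> 'n rvec"
  where "emb \<equiv> zero_ext v"

lemma comp_emb: "k \<in> outs \<Longrightarrow> l < v \<Longrightarrow> comp k l (emb c) = (if l = 0 then c $$ k else 0)"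
  using blk_sidx[of 0 v k] by (simp add: zero_ext_def comp_mkvec hat_sidx)

lemma out_emb: "out (emb c) = c"
  by (rule coord_eqI) (simp add: out_coord comp_emb v_pos flip: w)

lemma bounded_linear_emb: "bounded_linear emb"
proof -
  have "linear emb"
    by (rule linearI; rule comp_eqI) (simp_all add: comp_emb comp_linear coord_algebra)
  then show ?thesis by (simp add: linear_conv_bounded_linear)
qed

lemma emb_axis: "a \<in> outs \<Longrightarrow> emb (axis (idx a) 1) = unit_vec a 0"
  by (rule comp_eqI) (auto simp: comp_emb comp_unit_vec coord_axis v_pos w simp del: atLeastAtMost_iff)

lemma out_unit_vec: "a \<in> outs \<Longrightarrow> out (unit_vec a 0) = axis (idx a) 1"
  by (metis emb_axis out_emb)

lemma fully_measured_form_iff: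
  "fully_measured_form v W p B \<longleftrightarrow>
    (\<forall>x\<in>W. p x = (\<Sum>r<v. (D ^^ r) (\<lambda>x. B r (out x) :: 'w rvec) x))"
proof -
  have "{0..v - 1} = {..<v}" using v_pos by auto
  then show ?thesis by (simp add: fully_measured_form_def total_D_eq out_def)
qed

lemma PH_on_if_fully_measured:
  fixes p :: "'n rvec \<Rightarrow> 'w rvec"
  assumes W: "open W" "open (out ` W)"
    and B: "\<And>r. r < v \<Longrightarrow> smooth_on (out ` W) (B r)" and form: "fully_measured_form v W p B"
  shows "PH_on W p"
proof -
  have basic: "basic_on W (\<lambda>x. B r (out x))" if "r < v" for r
    using W that by (intro basic_on_out[OF W(2) B]) auto
  have PH_sum: "PH_on W (\<lambda>x. \<Sum>r<v. (D ^^ r) (\<lambda>x. B r (out x)) x)"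
  proof (rule PH_on_sum[OF W(1)])
    fix r assume r: "r \<in> {..<v}"
    show "PH_on W ((D ^^ r) (\<lambda>x. B r (out x)))"
      using r by (intro PH_on_D_pow[OF W(1) basic]) auto
    show "smooth_on W ((D ^^ r) (\<lambda>x. B r (out x)))"
      using basic r by (intro smooth_on_D_pow W(1)) (simp add: basic_on_def)
  qed
  show ?thesis
  proof (rule PH_on_cong[OF W(1), THEN iffD2, OF _ PH_sum])
    show "p x = (\<Sum>r<v. (D ^^ r) (\<lambda>x. B r (out x)) x)" if "x \<in> W" for x
      using form that unfolding fully_measured_form_iff by blast
  qed
qed

context
  fixes W :: "'n rvec set"
  assumes W: "open W"
    and path: "\<And>c j s. c \<in> out ` W \<Longrightarrow> j \<in> outs \<Longrightarrow> s \<in> closed_segment 0 (c $$ j) \<Longrightarrow>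
      emb (set_comp j s (keep_first j c)) \<in> W"
begin

lemma emb_in_iff: "emb c \<in> W \<longleftrightarrow> c \<in> out ` W"
proof
  show "c \<in> out ` W" if "emb c \<in> W" using that out_emb[of c] by (metis image_eqI)
  assume c: "c \<in> out ` W"
  have w1: "w \<in> outs" using w zero_less_card_finite[where 'a='w] by simp
  \<comment> \<open>The end of the last leg is \<open>c\<close> itself, so the path condition puts
    the zero section over every output value into \<open>W\<close>.\<close>
  have "set_comp w (c $$ w) (keep_first w c) = c"
    by (rule coord_eqI) (simp add: set_comp_def keep_first_def coord_mkvec w)
  then show "emb c \<in> W" using path[OF c w1, of "c $$ w"] by simp
qed

lemma open_out_image: "open (out ` W)"
proof -
  have "out ` W = emb -` W" using emb_in_iff by auto
  then show ?thesis using W bounded_linear_emb by (simp add: open_vimage linear_continuous_on)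
qed

lemma smooth_on_emb: "smooth_on W F \<Longrightarrow> smooth_on (out ` W) (\<lambda>c. F (emb c))"
  by (rule smooth_on_compose[OF open_out_image _ smooth_on_bounded_linear[OF bounded_linear_emb]])
    (auto simp: emb_in_iff)

context
  fixes p :: "'n rvec \<Rightarrow> 'w rvec"
  assumes p: "smooth_on W p" and PH: "PH_on W p" and slices: "\<And>c. connected {x \<in> W. out x = c}"
begin

text \<open>The coefficient of the \<open>j\<close>-th differential in the 1-form on the output
  space that has \<open>B_{k,r}\<close> as potential.\<close>

definition slope :: "nat \<Rightarrow> nat \<Rightarrow> nat \<Rightarrow> 'w rvec \<Rightarrow> real"
  where "slope r k j c = pd j r (\<lambda>x. p x $$ k) (emb c)"

definition integral_coeff :: "nat \<Rightarrow> 'w rvec \<Rightarrow> 'w rvec"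
  where "integral_coeff r c = (if r = 0 then p (emb c) else mkvec (\<lambda>k. path_integral (slope r k) c))"

lemma smooth_on_p_coord: "smooth_on W (\<lambda>x. p x $$ k)"
  by (rule smooth_on_linear_compose[OF W bounded_linear_coord p])

text \<open>The condition at the indices \<open>r\<close> and 0 has the coefficient
  \<open>r choose r = 1\<close> and moves the index \<open>r\<close> from \<open>b\<close> to
  \<open>a\<close>. With symmetry of second derivatives this is the closedness of the 1-form given
  by \<open>slope r k\<close>.\<close>

lemma PH_symmetric:
  assumes x: "x \<in> W" and ab: "a \<in> outs" "b \<in> outs" and r: "r < v"
  shows "pd a 0 (pd b r p) x = pd b 0 (pd a r p) x"
proof -
  have "pd b r (pd a 0 p) x =
      (if r + 0 < v then real ((r + 0) choose r) *\<^sub>R pd b 0 (pd a (r + 0) p) x else 0)"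
    using PH x ab r v_pos unfolding PH_on_def by blast
  then show ?thesis using r ddir_commute[OF W x p, of "unit_vec b r" "unit_vec a 0"] by simp
qed

lemma closed_form_slope:
  assumes r: "r < v"
  shows "closed_form (out ` W) (slope r k)"
proof
  show "open (out ` W)" by (rule open_out_image)
  show "set_comp j s (keep_first j c) \<in> out ` W"
    if "c \<in> out ` W" "j \<in> {1..CARD('w)}" "s \<in> closed_segment 0 (c $$ j)" for c j s
    using path[OF that(1) _ that(3)] that(2) emb_in_iff by (simp add: w)
  show "smooth_on (out ` W) (slope r k j)" for j
    unfolding slope_def[abs_def] by (intro smooth_on_emb smooth_on_ddir smooth_on_p_coord)
  fix c i j assume c: "c \<in> out ` W" and ij: "i \<in> {1..CARD('w)}" "j \<in> {1..CARD('w)}"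
  then have ij': "i \<in> outs" "j \<in> outs" by (simp_all add: w)
  have y: "emb c \<in> W" using c emb_in_iff by simp
  have *: "ddir (axis (idx a) 1) (slope r k b) c = pd a 0 (pd b r p) (emb c) $$ k"
    if "a \<in> outs" for a b
  proof -
    have "ddir (axis (idx a) 1) (slope r k b) c =
        ddir (ddir (axis (idx a) 1) emb c) (pd b r (\<lambda>x. p x $$ k)) (emb c)"
      unfolding slope_def[abs_def]
      by (intro ddir_compose(1) bounded_linear_imp_differentiable bounded_linear_emb
          smooth_on_differentiable[OF smooth_on_ddir[OF smooth_on_p_coord] y])
    then show ?thesis
      using that by (simp add: ddir_bounded_linear bounded_linear_emb emb_axis ddir_ddir_coord[OF W p y])
  qed
  show "ddir (axis (idx i) 1) (slope r k j) c = ddir (axis (idx j) 1) (slope r k i) c"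
    unfolding *[OF ij'(1)] *[OF ij'(2)] PH_symmetric[OF y ij' r] ..
qed

lemma smooth_on_integral_coeff: "r < v \<Longrightarrow> smooth_on (out ` W) (integral_coeff r)"
proof (cases "r = 0")
  case True
  then show ?thesis unfolding integral_coeff_def[abs_def] using smooth_on_emb[OF p] by simp
next
  case False
  assume r: "r < v"
  show ?thesis
    unfolding integral_coeff_def[abs_def]
    by (rule smooth_on_coordI[OF open_out_image])
      (simp add: False coord_mkvec closed_form.smooth_on_path_integral[OF closed_form_slope[OF r]])
qed

text \<open>The potential property; it makes the derivatives of the defect vanish on the zero
  section, the starting values for the slices.\<close>

lemma pd_integral_coeff:
  assumes r: "0 < r" "r < v" and a: "a \<in> outs" and x: "x \<in> W"
  shows "pd a 0 (\<lambda>x. integral_coeff r (out x)) x = pd a r p (emb (out x))"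
proof (rule coord_eqI)
  fix k assume k: "k \<in> {1..CARD('w)}"
  have c: "out x \<in> out ` W" using x by simp
  have y: "emb (out x) \<in> W" using emb_in_iff c by blast
  note d = smooth_on_differentiable[OF smooth_on_integral_coeff[OF r(2)] c]
  have "pd a 0 (\<lambda>x. integral_coeff r (out x)) x = ddir (axis (idx a) 1) (integral_coeff r) (out x)"
    using ddir_compose(1)[OF bounded_linear_imp_differentiable[OF bounded_linear_out] d] a
    by (simp add: ddir_bounded_linear bounded_linear_out out_unit_vec)
  also have "\<dots> $$ k = ddir (axis (idx a) 1) (\<lambda>c. integral_coeff r c $$ k) (out x)"
    by (rule ddir_linear_compose[OF bounded_linear_coord d, symmetric])
  also have "(\<lambda>c. integral_coeff r c $$ k) = path_integral (slope r k)"
    using r(1) k by (simp add: fun_eq_iff integral_coeff_def coord_mkvec)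
  also have "ddir (axis (idx a) 1) (path_integral (slope r k)) (out x) = slope r k a (out x)"
    using a by (intro closed_form.partial_path_integral[OF closed_form_slope[OF r(2)] c]) (simp add: w)
  also have "\<dots> = pd a r p (emb (out x)) $$ k"
    unfolding slope_def by (rule ddir_linear_compose[OF bounded_linear_coord smooth_on_differentiable[OF p y]])
  finally show "pd a 0 (\<lambda>x. integral_coeff r (out x)) x $$ k = pd a r p (emb (out x)) $$ k" .
qed

lemma given_by_integrals_integral_coeff: "given_by_integrals v W p integral_coeff"
  unfolding given_by_integrals_def integral_coeff_def
  by (auto simp: coord_mkvec path_integral_def slope_def partial_eq_pd[symmetric])

text \<open>
  The defect of the fully measured form also satisfies the Pascal-Hessian condition, which makes
  its derivative in direction \<open>unit_vec a r\<close> constant on slices as soon as the derivatives of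
  higher index vanish; on the zero section it vanishes by the choice of the coefficients.
\<close>

lemma fully_measured_form_integral_coeff: "fully_measured_form v W p integral_coeff"
proof -
  let ?\<beta> = "\<lambda>r x. integral_coeff r (out x)"
  define S where "S x = (\<Sum>r<v. (D ^^ r) (?\<beta> r) x)" for x
  define q where "q x = p x - S x" for x
  have basic: "basic_on W (?\<beta> r)" if "r < v" for r
    by (rule basic_on_out[OF open_out_image smooth_on_integral_coeff[OF that] W]) simp
  have sm: "smooth_on W ((D ^^ m) (?\<beta> r))" if "r < v" for r m
    using basic[OF that] by (intro smooth_on_D_pow W) (simp add: basic_on_def)
  have smS: "smooth_on W S"
    unfolding S_def[abs_def] by (intro smooth_on_sum[OF W] sm) simp
  have smq: "smooth_on W q"
    unfolding q_def[abs_def] by (intro smooth_on_diff W p smS)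
  have "fully_measured_form v W S integral_coeff"
    by (simp add: fully_measured_form_iff S_def)
  then have "PH_on W S"
    using smooth_on_integral_coeff
    by (intro PH_on_if_fully_measured[OF W open_out_image, of integral_coeff]) simp_all
  then have PHq: "PH_on W q"
    unfolding q_def[abs_def] by (rule PH_on_diff[OF W p PH smS])
  have D_emb: "(D ^^ m) F (emb c) = 0" if "m > 0" for m and F :: "'n rvec \<Rightarrow> 'w rvec" and c
  proof -
    have "comp k l (emb c) = 0" if "k \<in> outs" "l \<in> {1..v-1}" for k l
      using that comp_emb[of k l c] v_pos by auto
    then show ?thesis using that by (cases m) (auto intro!: D_eq_0)
  qed
  have "pd a r q x = 0" if "0 < r" "r < v" "a \<in> outs" "x \<in> W" for a r x
    using that
  \<comment> \<open>The measure \<open>v - r\<close> makes the hypothesis available for all indices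
    above \<open>r\<close>.\<close>
  proof (induction "v - r" arbitrary: r a x rule: less_induct)
    case less
    note r = less.prems(1,2) and a = less.prems(3) and x = less.prems(4)
    define y where "y = emb (out x)"
    have y: "y \<in> W" "out y = out x"
      unfolding y_def using emb_in_iff x by (auto simp: out_emb)
    have "pd b l (pd a r q) z = 0" if z: "z \<in> W" and b: "b \<in> outs" and l: "l \<in> {1..<v}" for z b l
    proof -
      have "pd b l (pd a r q) z =
          (if l + r < v then real ((l + r) choose l) *\<^sub>R pd b 0 (pd a (l + r) q) z else 0)"
        using PHq z b a l r unfolding PH_on_def by auto
      moreover have "pd b 0 (pd a (l + r) q) z = 0" if lr: "l + r < v"
      proof -
        have "pd a (l + r) q u = 0" if "u \<in> W" for u
          using less.hyps[of "l + r" a u] lr l r a that by auto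
        then have "pd b 0 (pd a (l + r) q) z = pd b 0 (\<lambda>u. 0) z"
          by (rule ddir_cong[OF W z])
        then show ?thesis by simp
      qed
      ultimately show ?thesis by simp
    qed
    from eq_on_slice[OF W smooth_on_ddir[OF smq] this slices x y(1) refl y(2)]
    have "pd a r q x = pd a r q y" .
    also have "\<dots> = pd a r p y - pd a r S y"
      unfolding q_def[abs_def]
      by (rule ddir_diff[OF smooth_on_differentiable[OF p y(1)] smooth_on_differentiable[OF smS y(1)]])
    also have "pd a r S y = (\<Sum>s<v. pd a r ((D ^^ s) (?\<beta> s)) y)"
      unfolding S_def[abs_def] by (rule ddir_sum, rule smooth_on_differentiable[OF sm y(1)]) simp
    \<comment> \<open>On the zero section a single term survives: for \<open>s < r\<close> the
      binomial coefficient is 0, and for \<open>s > r\<close> a positive power of \<open>D\<close>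
      remains.\<close>
    also have "\<dots> = (\<Sum>s<v. if s = r then pd a 0 (?\<beta> r) y else 0)"
    proof (rule sum.cong[OF refl])
      fix s assume s: "s \<in> {..<v}"
      then have *: "pd a r ((D ^^ s) (?\<beta> s)) y =
          real (s choose r) *\<^sub>R (D ^^ (s - r)) (pd a 0 (?\<beta> s)) y"
        by (intro pd_D_pow[OF W basic a r(2) y(1)]) simp
      show "pd a r ((D ^^ s) (?\<beta> s)) y = (if s = r then pd a 0 (?\<beta> r) y else 0)"
      proof (cases s r rule: linorder_cases)
        case less
        then show ?thesis unfolding * by (simp add: binomial_eq_0)
      next
        case equal
        then show ?thesis unfolding * by simp
      next
        case greater
        then have "(D ^^ (s - r)) (pd a 0 (?\<beta> s)) y = 0"
          unfolding y_def by (intro D_emb) simp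
        then show ?thesis unfolding * using greater by simp
      qed
    qed
    also have "\<dots> = pd a r p y"
      using r a by (simp add: pd_integral_coeff[OF r a y(1)] y(2)) (simp add: y_def)
    finally show ?case by simp
  qed
  note q_flat = this
  have "p x = S x" if x: "x \<in> W" for x
  proof -
    define y where "y = emb (out x)"
    have y: "y \<in> W" "out y = out x"
      unfolding y_def using emb_in_iff x by (auto simp: out_emb)
    have "q x = q y"
      by (rule eq_on_slice[OF W smq _ slices x y(1) refl y(2)]) (use q_flat in auto)
    also have "S y = (\<Sum>s<v. if s = 0 then ?\<beta> 0 y else 0)"
      unfolding S_def by (intro sum.cong refl) (auto simp: y_def D_emb)
    then have "q y = 0"
      using v_pos by (simp add: q_def integral_coeff_def y_def out_emb)
    finally show ?thesis by (simp add: q_def)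
  qed
  then show ?thesis unfolding fully_measured_form_iff S_def by blast
qed

end

end

end

theorem theorem3:
  fixes f :: "'n::{finite,linorder} rvec \<Rightarrow> 'n rvec"
    and h :: "'n rvec \<Rightarrow> 'w::{finite,linorder} rvec"
    and U :: "'n rvec set"
    and v :: nat
    and \<Psi> :: "'n rvec \<Rightarrow> 'n rvec"
    and p :: "'n rvec \<Rightarrow> 'w rvec"
  assumes dim: "CARD('n) = CARD('w) * v"
    and "open U" "smooth_on U f" "smooth_on U h"
    and observable: "\<And>\<xi>. \<xi> \<in> U \<Longrightarrow>
      dim (span {covector ((lie f ^^ j) (\<lambda>\<eta>. h \<eta> $$ i)) \<xi> | i j.
                   i \<in> {1..CARD('w)} \<and> j \<in> {0..v - 1}}) = CARD('n)"
    and diffeo: "diffeo_on U \<Psi>"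
    and \<Psi>: "\<And>\<xi> i j. \<lbrakk>\<xi> \<in> U; i \<in> {1..CARD('w)}; j \<in> {0..v - 1}\<rbrakk> \<Longrightarrow>
      \<Psi> \<xi> $$ (sidx v i + j) = (lie f ^^ j) (\<lambda>\<eta>. h \<eta> $$ i) \<xi>"
    and p: "\<And>\<xi> k. \<lbrakk>\<xi> \<in> U; k \<in> {1..CARD('w)}\<rbrakk> \<Longrightarrow>
      p (\<Psi> \<xi>) $$ k = (lie f ^^ v) (\<lambda>\<eta>. h \<eta> $$ k) \<xi>"
    and region: "admissible_region v TYPE('w) (\<Psi> ` U)"
  shows "((\<exists>B. given_by_integrals v (\<Psi> ` U) p B \<and>
               (\<forall>r \<in> {0..v - 1}. smooth_on (first_block v ` \<Psi> ` U) (B r)) \<and>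
               fully_measured_form v (\<Psi> ` U) p B \<and>
               transformable_to_ocf v (\<Psi> ` U) (high_order_field v p)
                 (first_block v :: 'n rvec \<Rightarrow> 'w rvec))
          \<longleftrightarrow> pascal_hessian v (\<Psi> ` U) p)
    \<and> (\<forall>B. (\<forall>r \<in> {0..v - 1}. smooth_on (first_block v ` \<Psi> ` U) (B r)) \<and>
            fully_measured_form v (\<Psi> ` U) p B \<longrightarrow>
            transformable_to_ocf v (\<Psi> ` U) (high_order_field v p)
              (first_block v :: 'n rvec \<Rightarrow> 'w rvec))"
proof -
  interpret block_coordinates v "CARD('w)" "TYPE('n)" "TYPE('w)"
    by standard (simp_all add: dim)
  define W where "W = \<Psi> ` U"
  have W: "open W" and inj: "inj_on \<Psi> U" and inv: "smooth_on W (inv_into U \<Psi>)"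
    using diffeo by (auto simp: diffeo_on_def W_def)
  have smooth_p: "smooth_on W p"
  proof (rule smooth_on_coordI[OF W])
    fix k assume k: "k \<in> {1..CARD('w)}"
    \<comment> \<open>\<open>p\<close> is prescribed only through the original coordinates, so its
      smoothness is carried over from the iterated Lie derivative by the smooth inverse of
      \<open>\<Psi>\<close>.\<close>
    have "smooth_on U ((lie f ^^ v) (\<lambda>\<eta>. h \<eta> $$ k))"
      by (intro smooth_on_lie_pow assms(2,3)
          smooth_on_linear_compose[OF assms(2) bounded_linear_coord assms(4)])
    then have lie_inv: "smooth_on W (\<lambda>x. (lie f ^^ v) (\<lambda>\<eta>. h \<eta> $$ k) (inv_into U \<Psi> x))"
      by (rule smooth_on_compose[OF W _ inv]) (auto simp: W_def inv_into_into)
    show "smooth_on W (\<lambda>x. p x $$ k)"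
    proof (rule smooth_on_cong[OF W, THEN iffD2, OF _ lie_inv])
      show "p x $$ k = (lie f ^^ v) (\<lambda>\<eta>. h \<eta> $$ k) (inv_into U \<Psi> x)" if "x \<in> W" for x
        using that p[OF _ k] inj by (auto simp: W_def inv_into_f_f)
    qed
  qed
  have path: "emb (set_comp j s (keep_first j c)) \<in> W"
    if "c \<in> out ` W" "j \<in> {1..CARD('w)}" "s \<in> closed_segment 0 (c $$ j)" for c j s
    using region that unfolding admissible_region_def W_def out_def by blast
  have slices: "connected {x \<in> W. out x = c}" for c
    using region unfolding admissible_region_def W_def out_def by blast
  have N: "open (out ` W)"
    by (rule open_out_image[OF W path])
  have index: "(\<forall>r\<in>{0..v - 1}. smooth_on (out ` W) (B r)) \<longleftrightarrow> (\<forall>r<v. smooth_on (out ` W) (B r))"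
    for B :: "nat \<Rightarrow> 'w rvec \<Rightarrow> 'w rvec"
    using v_pos by auto
  \<comment> \<open>Any smooth coefficients of a fully measured form suffice here, not only the
    integrals; this is the second half of the claim.\<close>
  have ocf: "transformable_to_ocf v W (high_order_field v p) (out :: 'n rvec \<Rightarrow> 'w rvec)"
    if "\<forall>r<v. smooth_on (out ` W) (B r)" "fully_measured_form v W p B" for B
    using that unfolding fully_measured_form_iff
    by (intro transformable_to_ocf_if_fully_measured[OF N _ W refl]) auto
  have necessary: "PH_on W p"
    if "\<forall>r<v. smooth_on (out ` W) (B r)" "fully_measured_form v W p B" for B
    using that by (intro PH_on_if_fully_measured[OF W N]) auto
  have sufficient: "\<exists>B. given_by_integrals v W p B \<and> (\<forall>r<v. smooth_on (out ` W) (B r)) \<and>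
      fully_measured_form v W p B" if PH: "PH_on W p"
    using given_by_integrals_integral_coeff[OF W path smooth_p PH slices]
      smooth_on_integral_coeff[OF W path smooth_p PH slices]
      fully_measured_form_integral_coeff[OF W path smooth_p PH slices] by blast
  show ?thesis
    unfolding W_def[symmetric] out_def[symmetric] index pascal_hessian_iff[OF W smooth_p]
    using ocf necessary sufficient by blast
qed

end
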